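(* Let $k\ge 3$, $n\ge1$, and let $\Omega$ be a domain in $\mathbb R^{kn}$. The short sequence $$0\rightarrow\Gamma(\Omega,\mathcal V_0)\xrightarrow{\mathcal D_0}\Gamma(\Omega,\mathcal V_1)\xrightarrow{\mathcal D_1}\Gamma(\Omega,\mathcal V_2)\xrightarrow{\mathcal D_2=(\mathcal D_2',\mathcal D_2'')}\Gamma(\Omega,\mathcal V_3')\oplus\Gamma(\Omega,\mathcal V_3'')$$ is an elliptic complex, i.e. $\mathcal D_{j+1}\circ\mathcal D_j=0$ for $j=0,1$, and for every $\xi\in\mathbb R^{kn}\setminus\{\mathbf 0\}$ one has $\ker\sigma_0(\xi)=\{0\}$ and $\ker\sigma_j(\xi)=\operatorname{Im}\sigma_{j-1}(\xi)$ for $j=1,2$, where $\ker\sigma_2(\xi)=\ker\sigma_2'(\xi)\cap\ker\sigma_2''(\xi)$.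
   Context: Spinors. $\mathbb S^\pm$ are the two spinor modules of the real Clifford algebra generated by $e_1,\dots,e_n$ with $e_ie_j+e_je_i=-2\delta_{ij}$ when $n$ is even; for $n$ odd the same symbols are used with the convention that $\mathbb S^+$ and $\mathbb S^-$ are isomorphic (copies of the spinor module). $\gamma_j:\mathbb S^\pm\to\mathbb S^\mp$ denotes the action of $e_j$, so $\gamma_i\gamma_j+\gamma_j\gamma_i=-2\delta_{ij}\mathrm{Id}$. Dirac operators. Points of $\mathbb R^{kn}$ are $(\mathbf x_0,\dots,\mathbf x_{k-1})$, $\mathbf x_A=(x_{A1},\dots,x_{An})$; $\partial_{Aj}=\partial/\partial x_{Aj}$; $\nabla_A=\sum_{j=1}^n\gamma_j\partial_{Aj}$, mapping $\mathbb S^\pm$-valued functions to $\mathbb S^\mp$-valued functions; $\Delta_{BC}=\nabla_B\nabla_C+\nabla_C\nabla_B$. $\Gamma(\Omega,E)$ denotes smooth $E$-valued functions on $\Omega$. Index conventions. Indices $A,B,C,D,E$ run over $0,\dots,k-1$. Brackets $[\cdots]$ denote skewsymmetrization, $f_{[A_1\cdots A_p]}=\frac1{p!}\sum_{\sigma\in S_p}\mathrm{sign}(\sigma)f_{A_{\sigma(1)}\cdots A_{\sigma(p)}}$, underlined indices inside a bracket being left in place and not skewsymmetrized; e.g. $h_{[A\underline BC]}=\frac12(h_{ABC}-h_{CBA})$, $h_{D[A\underline BC]}=\frac12(h_{DABC}-h_{DCBA})$, and $h_{[E\underline DA\underline BC]}$ is the average with signs over the six permutations of $E,A,C$ in positions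 $1,3,5$. $\sum_{(B,\dots,C)}$ means the sum over all permutations of the listed indices. An element of $\otimes^l\mathbb C^k$ (or $\otimes^l\mathbb C^k\otimes\mathbb S^\pm$) is identified with its tuple of components $(h_{A_1\dots A_l})$ (with values in $\mathbb C$, resp. $\mathbb S^\pm$). Spaces. $V_{210\dots}\subset\otimes^3\mathbb C^k$, $V_{220\dots}\subset\otimes^4\mathbb C^k$, $V_{3110\dots}\subset\otimes^5\mathbb C^k$ are the images of the linear maps $C_{21}(h)_{ABC}=\frac23\sum_{(B,C)}h_{[A\underline BC]}$, $C_{22}(h)_{DABC}=\frac16\sum_{(A,D),(B,C)}\big(h_{D[A\underline BC]}+h_{B[C\underline DA]}\big)$, $C_{311}(h)_{EDABC}=\frac3{10}\sum_{(D,B,C)}h_{[E\underline DA\underline BC]}$. Put $\mathcal V_0=\mathbb S^+$, $\mathcal V_1=\mathbb C^k\otimes\mathbb S^-$, $\mathcal V_2=V_{210\dots}\otimes\mathbb S^-$, $\mathcal V_3'=V_{220\dots}\otimes\mathbb S^+$, $\mathcal V_3''=V_{3110\dots}\otimes\mathbb S^-$. Operators. $(\mathcal D_0f)_A=\nabla_Af$, $(\mathcal D_1F)_{ABC}=\sum_{(B,C)}\nabla_{[A}\nabla_{\underline B}F_{C]}$, $(\mathcal D_2'h)_{DABC}=\sum_{(A,D),(B,C)}\big(\nabla_Dh_{[A\underline BC]}+\nabla_Bh_{[C\underline DA]}\big)$, $(\mathcal D_2''h)_{EDABC}=\frac12\sum_{(D,B,C)}\big(2\nabla_{[E}\nabla_{\underline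 D}h_{A]BC}+\nabla_D\nabla_{[E}h_{A]BC}+\Delta_{BC}h_{[E\underline DA]}\big)$ (in the terms $[E\cdots A]$ only $E$ and $A$ are skewsymmetrized). Symbols. For $\xi=(\xi_{Aj})\in\mathbb R^{kn}$ put $\boldsymbol\xi_A=-\mathbf i\sum_j\gamma_j\xi_{Aj}:\mathbb S^\pm\to\mathbb S^\mp$ and $\boldsymbol\xi_{BC}=\boldsymbol\xi_B\boldsymbol\xi_C+\boldsymbol\xi_C\boldsymbol\xi_B$. The symbols $\sigma_0(\xi):\mathcal V_0\to\mathcal V_1$, $\sigma_1(\xi):\mathcal V_1\to\mathcal V_2$, $\sigma_2'(\xi):\mathcal V_2\to\mathcal V_3'$, $\sigma_2''(\xi):\mathcal V_2\to\mathcal V_3''$ of $\mathcal D_0,\mathcal D_1,\mathcal D_2',\mathcal D_2''$ are obtained by replacing $\nabla_A$ by $\boldsymbol\xi_A$ and $\Delta_{BC}$ by $\boldsymbol\xi_{BC}$ in the formulas above, and $\sigma_2(\xi)=(\sigma_2'(\xi),\sigma_2''(\xi))$. *)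

theory Defs
  imports "HOL-Analysis.Analysis"
begin

text \<open>
  Conventions. The index sets \<open>{1,\<dots>,n}\<close> and \<open>{0,\<dots>,k-1}\<close> are finite types \<open>'n\<close> and \<open>'k\<close>;
  a point of \<open>\<real>\<^sup>k\<^sup>n\<close> is \<open>x :: real^'n^'k\<close> with \<open>x\<^sub>A\<^sub>j = x $ A $ j\<close>.
  An \<open>l\<close>-tensor over \<open>\<complex>\<^sup>k\<close>, scalar or spinor valued, is a vector indexed by \<open>l\<close>-tuples over \<open>'k\<close>.
  The complex vector spaces \<open>S\<^sup>+\<close> and \<open>S\<^sup>-\<close> are \<open>complex^'p\<close> and \<open>complex^'m\<close>; the action of \<open>e\<^sub>j\<close>
  is given by matrices \<open>gp j : S\<^sup>+ \<rightarrow> S\<^sup>-\<close> and \<open>gm j : S\<^sup>- \<rightarrow> S\<^sup>+\<close>.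
\<close>


section \<open>Spinor modules\<close>

text \<open>
  By the universal property of the Clifford algebra, a complex module over it is the same as a
  family of matrices satisfying the Clifford relations; a spinor module is an irreducible one.
\<close>

definition clifford_module :: "('n::finite \<Rightarrow> complex^'s^'s) \<Rightarrow> bool" where
  "clifford_module c \<longleftrightarrow>
     (\<forall>i j. c i ** c j + c j ** c i = mat (if i = j then -2 else 0))"

definition spinor_module :: "('n::finite \<Rightarrow> complex^'s^'s) \<Rightarrow> bool" where
  "spinor_module c \<longleftrightarrow> clifford_module c \<and>
     (\<forall>U. vec.subspace U \<and> (\<forall>j. \<forall>u\<in>U. c j *v u \<in> U) \<longrightarrow> U = {0} \<or> U = UNIV)"

text \<open>The action of \<open>e\<^sub>j\<close> on \<open>S\<^sup>+ \<oplus> S\<^sup>-\<close>, which interchanges the two summands.\<close>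

definition odd_action ::
  "('n::finite \<Rightarrow> complex^'p^'m) \<Rightarrow> ('n \<Rightarrow> complex^'m^'p) \<Rightarrow> 'n \<Rightarrow> complex^('p + 'm)^('p + 'm)" where
  "odd_action gp gm j = (\<chi> r c. case (r, c) of
       (Inr b, Inl a) \<Rightarrow> gp j $ b $ a
     | (Inl a, Inr b) \<Rightarrow> gm j $ a $ b
     | _ \<Rightarrow> 0)"

text \<open>
  For \<open>n\<close> even, \<open>S\<^sup>+\<close> and \<open>S\<^sup>-\<close> are the two halves of the spinor module \<open>S = S\<^sup>+ \<oplus> S\<^sup>-\<close>: the generators
  interchange the summands, so by irreducibility these are the eigenspaces of the volume element.
  For \<open>n\<close> odd, \<open>S\<^sup>+\<close> and \<open>S\<^sup>-\<close> are copies of one spinor module \<open>S\<close>. Taking \<open>S = S\<^sup>+\<close> with generators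
  \<open>c\<^sub>j\<close> and the copy \<open>J : S\<^sup>+ \<rightarrow> S\<^sup>-\<close>, the maps \<open>e\<^sub>j : S\<^sup>\<plusminus> \<rightarrow> S\<^sup>\<mp>\<close> are \<open>J c\<^sub>j\<close> and \<open>c\<^sub>j J\<^sup>-\<^sup>1\<close>.
\<close>

definition spinor_modules ::
  "('n::finite \<Rightarrow> complex^'p^'m) \<Rightarrow> ('n \<Rightarrow> complex^'m^'p) \<Rightarrow> bool" where
  "spinor_modules gp gm \<longleftrightarrow>
     (if even CARD('n) then spinor_module (odd_action gp gm)
      else (\<exists>(J :: complex^'p^'m) (J' :: complex^'m^'p) c.
              J ** J' = mat 1 \<and> J' ** J = mat 1 \<and> spinor_module c \<and>
              (\<forall>j. gp j = J ** c j \<and> gm j = c j ** J')))"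


section \<open>Smooth functions and Dirac operators\<close>

text \<open>For an open set \<open>S\<close>, \<open>Ck_on m f S\<close> says that \<open>f\<close> is of class \<open>C\<^sup>m\<close> on \<open>S\<close>.\<close>

primrec Ck_on :: "nat \<Rightarrow> ('a::euclidean_space \<Rightarrow> 'b::real_normed_vector) \<Rightarrow> 'a set \<Rightarrow> bool" where
  "Ck_on 0 f S = continuous_on S f"
| "Ck_on (Suc m) f S =
     (f differentiable_on S \<and> (\<forall>v\<in>Basis. Ck_on m (\<lambda>x. frechet_derivative f (at x) v) S))"

definition smooth_on :: "('a::euclidean_space \<Rightarrow> 'b::real_normed_vector) \<Rightarrow> 'a set \<Rightarrow> bool" where
  "smooth_on f S \<longleftrightarrow> (\<forall>m. Ck_on m f S)"

text \<open>
  Functions on \<open>\<Omega>\<close> are total functions whose values outside \<open>\<Omega>\<close> are irrelevant: for \<open>\<Omega>\<close> open,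
  derivatives at points of \<open>\<Omega>\<close> depend only on the values in \<open>\<Omega>\<close>.
\<close>

definition Gam :: "'a::euclidean_space set \<Rightarrow> 'b::real_normed_vector set \<Rightarrow> ('a \<Rightarrow> 'b) set" where
  "Gam \<Omega> V = {f. smooth_on f \<Omega> \<and> (\<forall>x\<in>\<Omega>. f x \<in> V)}"

definition pd ::
  "'k::finite \<Rightarrow> 'n::finite \<Rightarrow> (real^'n^'k \<Rightarrow> 'b::real_normed_vector) \<Rightarrow> real^'n^'k \<Rightarrow> 'b" where
  "pd A j f x = frechet_derivative f (at x) (axis A (axis j 1))"

definition nabla :: "('n::finite \<Rightarrow> complex^'a^'b) \<Rightarrow> 'k::finite \<Rightarrow>
    (real^'n^'k \<Rightarrow> complex^'a) \<Rightarrow> real^'n^'k \<Rightarrow> complex^'b" where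
  "nabla g A f x = (\<Sum>j\<in>UNIV. g j *v pd A j f x)"

text \<open>\<open>\<Delta>\<^sub>B\<^sub>C\<close> is only needed on \<open>S\<^sup>-\<close>-valued functions.\<close>

definition Delta :: "('n::finite \<Rightarrow> complex^'p^'m) \<Rightarrow> ('n \<Rightarrow> complex^'m^'p) \<Rightarrow> 'k::finite \<Rightarrow> 'k \<Rightarrow>
    (real^'n^'k \<Rightarrow> complex^'m) \<Rightarrow> real^'n^'k \<Rightarrow> complex^'m" where
  "Delta gp gm B C f x = nabla gp B (nabla gm C f) x + nabla gp C (nabla gm B f) x"

definition xi_sym :: "('n::finite \<Rightarrow> complex^'a^'b) \<Rightarrow> real^'n^'k::finite \<Rightarrow> 'k \<Rightarrow>
    complex^'a \<Rightarrow> complex^'b" where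
  "xi_sym g \<xi> A v = (- \<i>) *s (\<Sum>j\<in>UNIV. complex_of_real (\<xi> $ A $ j) *s (g j *v v))"

definition xi_sym2 :: "('n::finite \<Rightarrow> complex^'p^'m) \<Rightarrow> ('n \<Rightarrow> complex^'m^'p) \<Rightarrow>
    real^'n^'k::finite \<Rightarrow> 'k \<Rightarrow> 'k \<Rightarrow> complex^'m \<Rightarrow> complex^'m" where
  "xi_sym2 gp gm \<xi> B C v =
     xi_sym gp \<xi> B (xi_sym gm \<xi> C v) + xi_sym gp \<xi> C (xi_sym gm \<xi> B v)"


section \<open>Tensors\<close>

text \<open>
  \<open>alt2 (\<lambda>A C. h A B C) A C\<close> is \<open>h\<close> skewsymmetrized in \<open>A, C\<close>, with \<open>B\<close> left in place;
  \<open>symsum2 (\<lambda>B C. h A B C) B C\<close> is the sum over all permutations of \<open>B, C\<close>, without a factor 1/2.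
\<close>

definition alt2 :: "('k \<Rightarrow> 'k \<Rightarrow> 'v::real_vector) \<Rightarrow> 'k \<Rightarrow> 'k \<Rightarrow> 'v" where
  "alt2 f A C = (1/2) *\<^sub>R (f A C - f C A)"

definition alt3 :: "('k \<Rightarrow> 'k \<Rightarrow> 'k \<Rightarrow> 'v::real_vector) \<Rightarrow> 'k \<Rightarrow> 'k \<Rightarrow> 'k \<Rightarrow> 'v" where
  "alt3 f E A C =
     (1/6) *\<^sub>R (f E A C + f A C E + f C E A - f A E C - f E C A - f C A E)"

definition symsum2 :: "('k \<Rightarrow> 'k \<Rightarrow> 'v::real_vector) \<Rightarrow> 'k \<Rightarrow> 'k \<Rightarrow> 'v" where
  "symsum2 f B C = f B C + f C B"

definition symsum3 :: "('k \<Rightarrow> 'k \<Rightarrow> 'k \<Rightarrow> 'v::real_vector) \<Rightarrow> 'k \<Rightarrow> 'k \<Rightarrow> 'k \<Rightarrow> 'v" where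
  "symsum3 f D B C = f D B C + f B C D + f C D B + f B D C + f D C B + f C B D"

definition C21 :: "complex^('k \<times> 'k \<times> 'k) \<Rightarrow> complex^('k::finite \<times> 'k \<times> 'k)" where
  "C21 h = vec_lambda (\<lambda>(A, B, C).
     (2/3) *\<^sub>R symsum2 (\<lambda>B C. alt2 (\<lambda>A C. h $ (A, B, C)) A C) B C)"

definition C22 :: "complex^('k \<times> 'k \<times> 'k \<times> 'k) \<Rightarrow> complex^('k::finite \<times> 'k \<times> 'k \<times> 'k)" where
  "C22 h = vec_lambda (\<lambda>(D, A, B, C).
     (1/6) *\<^sub>R symsum2 (\<lambda>A D. symsum2 (\<lambda>B C.
         alt2 (\<lambda>A C. h $ (D, A, B, C)) A C + alt2 (\<lambda>C A. h $ (B, C, D, A)) C A) B C) A D)"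

definition C311 ::
  "complex^('k \<times> 'k \<times> 'k \<times> 'k \<times> 'k) \<Rightarrow> complex^('k::finite \<times> 'k \<times> 'k \<times> 'k \<times> 'k)" where
  "C311 h = vec_lambda (\<lambda>(E, D, A, B, C).
     (3/10) *\<^sub>R symsum3 (\<lambda>D B C. alt3 (\<lambda>E A C. h $ (E, D, A, B, C)) E A C) D B C)"

definition V210 :: "(complex^('k::finite \<times> 'k \<times> 'k)) set" where
  "V210 = range C21"

definition V220 :: "(complex^('k::finite \<times> 'k \<times> 'k \<times> 'k)) set" where
  "V220 = range C22"

definition V3110 :: "(complex^('k::finite \<times> 'k \<times> 'k \<times> 'k \<times> 'k)) set" where
  "V3110 = range C311"

text \<open>\<open>V \<otimes> \<complex>\<^sup>s\<close>: the finite sums of simple tensors \<open>v \<otimes> s\<close> with \<open>v \<in> V\<close>.\<close>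

definition simple_tensor :: "complex^'i \<Rightarrow> complex^'s \<Rightarrow> complex^'s^'i" where
  "simple_tensor v s = (\<chi> i. v $ i *s s)"

definition tensor_spinor :: "(complex^'i) set \<Rightarrow> (complex^'s^'i) set" where
  "tensor_spinor V =
     {h. \<exists>(N::nat) v s. (\<forall>l<N. v l \<in> V) \<and> h = (\<Sum>l<N. simple_tensor (v l) (s l))}"

text \<open>
  The type arguments \<open>'p\<close> and \<open>'m\<close> below record the factor \<open>S\<^sup>+\<close> or \<open>S\<^sup>-\<close>.
\<close>

definition V0 :: "(complex^'p) set" where
  "V0 = UNIV"

definition V1 :: "(complex^'m^'k::finite) set" where
  "V1 = tensor_spinor UNIV"

definition V2 :: "(complex^'m^('k::finite \<times> 'k \<times> 'k)) set" where
  "V2 = tensor_spinor V210"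

definition V3' :: "(complex^'p^('k::finite \<times> 'k \<times> 'k \<times> 'k)) set" where
  "V3' = tensor_spinor V220"

definition V3'' :: "(complex^'m^('k::finite \<times> 'k \<times> 'k \<times> 'k \<times> 'k)) set" where
  "V3'' = tensor_spinor V3110"


section \<open>The operators and their symbols\<close>

definition D0 :: "('n::finite \<Rightarrow> complex^'p^'m) \<Rightarrow>
    (real^'n^'k::finite \<Rightarrow> complex^'p) \<Rightarrow> real^'n^'k \<Rightarrow> complex^'m^'k" where
  "D0 gp f x = (\<chi> A. nabla gp A f x)"

definition D1 :: "('n::finite \<Rightarrow> complex^'p^'m) \<Rightarrow> ('n \<Rightarrow> complex^'m^'p) \<Rightarrow>
    (real^'n^'k::finite \<Rightarrow> complex^'m^'k) \<Rightarrow> real^'n^'k \<Rightarrow> complex^'m^('k \<times> 'k \<times> 'k)" where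
  "D1 gp gm F x = vec_lambda (\<lambda>(A, B, C).
     symsum2 (\<lambda>B C. alt2 (\<lambda>A C. nabla gp A (nabla gm B (\<lambda>y. F y $ C)) x) A C) B C)"

definition D2' :: "('n::finite \<Rightarrow> complex^'m^'p) \<Rightarrow>
    (real^'n^'k::finite \<Rightarrow> complex^'m^('k \<times> 'k \<times> 'k)) \<Rightarrow>
    real^'n^'k \<Rightarrow> complex^'p^('k \<times> 'k \<times> 'k \<times> 'k)" where
  "D2' gm h x = vec_lambda (\<lambda>(D, A, B, C).
     symsum2 (\<lambda>A D. symsum2 (\<lambda>B C.
         nabla gm D (\<lambda>y. alt2 (\<lambda>A C. h y $ (A, B, C)) A C) x
       + nabla gm B (\<lambda>y. alt2 (\<lambda>C A. h y $ (C, D, A)) C A) x) B C) A D)"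

definition D2'' :: "('n::finite \<Rightarrow> complex^'p^'m) \<Rightarrow> ('n \<Rightarrow> complex^'m^'p) \<Rightarrow>
    (real^'n^'k::finite \<Rightarrow> complex^'m^('k \<times> 'k \<times> 'k)) \<Rightarrow>
    real^'n^'k \<Rightarrow> complex^'m^('k \<times> 'k \<times> 'k \<times> 'k \<times> 'k)" where
  "D2'' gp gm h x = vec_lambda (\<lambda>(E, D, A, B, C).
     (1/2) *\<^sub>R symsum3 (\<lambda>D B C.
         2 *\<^sub>R alt2 (\<lambda>E A. nabla gp E (nabla gm D (\<lambda>y. h y $ (A, B, C))) x) E A
       + nabla gp D (\<lambda>z. alt2 (\<lambda>E A. nabla gm E (\<lambda>y. h y $ (A, B, C)) z) E A) x
       + Delta gp gm B C (\<lambda>y. alt2 (\<lambda>E A. h y $ (E, D, A)) E A) x) D B C)"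

definition sigma0 :: "('n::finite \<Rightarrow> complex^'p^'m) \<Rightarrow> real^'n^'k::finite \<Rightarrow>
    complex^'p \<Rightarrow> complex^'m^'k" where
  "sigma0 gp \<xi> v = (\<chi> A. xi_sym gp \<xi> A v)"

definition sigma1 :: "('n::finite \<Rightarrow> complex^'p^'m) \<Rightarrow> ('n \<Rightarrow> complex^'m^'p) \<Rightarrow>
    real^'n^'k::finite \<Rightarrow> complex^'m^'k \<Rightarrow> complex^'m^('k \<times> 'k \<times> 'k)" where
  "sigma1 gp gm \<xi> F = vec_lambda (\<lambda>(A, B, C).
     symsum2 (\<lambda>B C. alt2 (\<lambda>A C. xi_sym gp \<xi> A (xi_sym gm \<xi> B (F $ C))) A C) B C)"

definition sigma2' :: "('n::finite \<Rightarrow> complex^'m^'p) \<Rightarrow> real^'n^'k::finite \<Rightarrow>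
    complex^'m^('k \<times> 'k \<times> 'k) \<Rightarrow> complex^'p^('k \<times> 'k \<times> 'k \<times> 'k)" where
  "sigma2' gm \<xi> h = vec_lambda (\<lambda>(D, A, B, C).
     symsum2 (\<lambda>A D. symsum2 (\<lambda>B C.
         xi_sym gm \<xi> D (alt2 (\<lambda>A C. h $ (A, B, C)) A C)
       + xi_sym gm \<xi> B (alt2 (\<lambda>C A. h $ (C, D, A)) C A)) B C) A D)"

definition sigma2'' :: "('n::finite \<Rightarrow> complex^'p^'m) \<Rightarrow> ('n \<Rightarrow> complex^'m^'p) \<Rightarrow>
    real^'n^'k::finite \<Rightarrow> complex^'m^('k \<times> 'k \<times> 'k) \<Rightarrow>
    complex^'m^('k \<times> 'k \<times> 'k \<times> 'k \<times> 'k)" where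
  "sigma2'' gp gm \<xi> h = vec_lambda (\<lambda>(E, D, A, B, C).
     (1/2) *\<^sub>R symsum3 (\<lambda>D B C.
         2 *\<^sub>R alt2 (\<lambda>E A. xi_sym gp \<xi> E (xi_sym gm \<xi> D (h $ (A, B, C)))) E A
       + xi_sym gp \<xi> D (alt2 (\<lambda>E A. xi_sym gm \<xi> E (h $ (A, B, C))) E A)
       + xi_sym2 gp gm \<xi> B C (alt2 (\<lambda>E A. h $ (E, D, A)) E A)) D B C)"

end

theory Submission
  imports Defs
begin

text \<open>
  Everything rests on one consequence of the Clifford relations: the anticommutator
  \<open>\<Delta>\<^sub>B\<^sub>C = \<nabla>\<^sub>B\<nabla>\<^sub>C + \<nabla>\<^sub>C\<nabla>\<^sub>B\<close> is the scalar operator \<open>-2 \<Sum>\<^sub>j \<partial>\<^sub>B\<^sub>j\<partial>\<^sub>C\<^sub>j\<close>, so it commutes with every \<open>\<nabla>\<^sub>A\<close>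
  (\<open>nabla3_relation\<close>, which needs the symmetry of second derivatives, \<open>dir_deriv_commute\<close>). For symbols
  the anticommutator of \<open>\<xi>\<^sub>B\<close> and \<open>\<xi>\<^sub>C\<close> is multiplication by the number \<open>2\<langle>\<xi>\<^sub>B, \<xi>\<^sub>C\<rangle>\<close>. The operators and
  their symbols are therefore instances of the same formal combinations of words in noncommuting
  letters, here \<open>young21\<close>, \<open>young22\<close>, \<open>young311\<close>, subject to the relation that anticommutators slide
  through a word.

  \<^item> \<^emph>\<open>Complex.\<close> That a composition vanishes is a linear identity between such words. For
    \<open>\<D>\<^sub>1\<D>\<^sub>0\<close> and \<open>\<D>\<^sub>2'\<D>\<^sub>1\<close> it is a sum of instances of the relation. For \<open>\<D>\<^sub>2''\<D>\<^sub>1\<close> one first rewrites the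
    words of length four by anticommutators times words of length two
    (\<open>young311_young21_eq_0_real\<close>).

  \<^item> \<^emph>\<open>Values.\<close> \<open>\<D>\<^sub>1\<close> and \<open>\<D>\<^sub>2'\<close> are, up to a factor, the defining maps of their target
    spaces applied to an unsymmetrized tensor. For \<open>\<D>\<^sub>2''\<close> one checks the symmetries that make a
    tensor a fixed point of \<open>C311\<close>; the only one that is not visible is the exchange
    identity \<open>young311_exchange\<close>.

  \<^item> \<^emph>\<open>Exactness.\<close> Choose an index \<open>z\<close> with \<open>\<xi>\<^sub>z \<noteq> 0\<close>; then \<open>\<xi>\<^sub>z\<close> is invertible. If \<open>\<sigma>\<^sub>1 F = 0\<close>, the component
    \<open>Azz\<close> of this equation reads \<open>|\<xi>\<^sub>z|\<^sup>2 F\<^sub>A = \<xi>\<^sub>A (\<xi>\<^sub>z F\<^sub>z)\<close>, so \<open>F\<close> is in the image of \<open>\<sigma>\<^sub>0\<close>. If \<open>\<sigma>\<^sub>2 h = 0\<close>, subtracting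
    \<open>\<sigma>\<^sub>1 F\<close> with \<open>F\<^sub>A = - h\<^sub>A\<^sub>z\<^sub>z / |\<xi>\<^sub>z|\<^sup>2\<close> makes all components \<open>h\<^sub>A\<^sub>z\<^sub>z\<close> vanish; setting suitable indices
    equal to \<open>z\<close> in \<open>\<sigma>\<^sub>2' h = 0\<close> and \<open>\<sigma>\<^sub>2'' h = 0\<close> then kills the remaining components one family
    after another (\<open>exact_2_gauge\<close>).
\<close>

section \<open>Young-symmetrized words in noncommuting letters\<close>

text \<open>
  For \<open>t A B C = \<nabla>\<^sub>A\<nabla>\<^sub>B F\<^sub>C\<close>, \<open>t D A B C = \<nabla>\<^sub>D h\<^sub>A\<^sub>B\<^sub>C\<close> and \<open>t E D A B C = \<nabla>\<^sub>E\<nabla>\<^sub>D h\<^sub>A\<^sub>B\<^sub>C\<close> the next three combinations are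
  \<open>\<D>\<^sub>1 F\<close>, \<open>\<D>\<^sub>2' h\<close> and \<open>2 \<D>\<^sub>2'' h\<close>; with \<open>\<xi>\<^sub>A\<close> in place of \<open>\<nabla>\<^sub>A\<close> they are the symbols.
\<close>

definition young21 :: "('k \<Rightarrow> 'k \<Rightarrow> 'k \<Rightarrow> 'v::real_vector) \<Rightarrow> 'k \<Rightarrow> 'k \<Rightarrow> 'k \<Rightarrow> 'v" where
  "young21 t A B C = symsum2 (\<lambda>B C. alt2 (\<lambda>A C. t A B C) A C) B C"

definition young22 :: "('k \<Rightarrow> 'k \<Rightarrow> 'k \<Rightarrow> 'k \<Rightarrow> 'v::real_vector) \<Rightarrow> 'k \<Rightarrow> 'k \<Rightarrow> 'k \<Rightarrow> 'k \<Rightarrow> 'v" where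
  "young22 t D A B C = symsum2 (\<lambda>A D. symsum2 (\<lambda>B C.
         alt2 (\<lambda>A C. t D A B C) A C + alt2 (\<lambda>C A. t B C D A) C A) B C) A D"

definition young311 :: "('k \<Rightarrow> 'k \<Rightarrow> 'k \<Rightarrow> 'k \<Rightarrow> 'k \<Rightarrow> 'v::real_vector)
    \<Rightarrow> 'k \<Rightarrow> 'k \<Rightarrow> 'k \<Rightarrow> 'k \<Rightarrow> 'k \<Rightarrow> 'v" where
  "young311 t E D A B C = symsum3 (\<lambda>D B C.
         2 *\<^sub>R alt2 (\<lambda>E A. t E D A B C) E A
       + alt2 (\<lambda>E A. t D E A B C) E A
       + alt2 (\<lambda>E A. t B C E D A + t C B E D A) E A) D B C"

lemmas young_defs = young21_def young22_def young311_def symsum2_def symsum3_def alt2_def alt3_def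

text \<open>
  Here \<open>t X Y Z V\<close> stands for the word \<open>\<nabla>\<^sub>X\<nabla>\<^sub>Y\<nabla>\<^sub>Z F\<^sub>V\<close>, and the assumption says that the anticommutator
  of \<open>Y\<close> and \<open>Z\<close> passes to the left of \<open>X\<close>. The claim is a linear combination of the instances with
  \<open>{X, Y, Z, V} = {A, B, C, D}\<close>.
\<close>

lemma young22_young21_eq_0_real:
  fixes t :: "'k \<Rightarrow> 'k \<Rightarrow> 'k \<Rightarrow> 'k \<Rightarrow> real"
  assumes r: "\<And>X Y Z V. t X Y Z V + t X Z Y V = t Y Z X V + t Z Y X V"
  shows "young22 (\<lambda>D. young21 (t D)) D A B C = 0"
proof -
  note r [of A B C D] r [of A B D C] r [of A C D B] r [of B A C D] r [of B A D C] r [of B C D A]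
      r [of C A B D] r [of C A D B] r [of C B D A] r [of D A B C] r [of D A C B] r [of D B C A]
  then show ?thesis
    by (simp add: young_defs algebra_simps)
qed

text \<open>
  In words \<open>t X Y Z W V\<close> of length four the anticommutator \<open>d\<close> of two letters may be moved to the
  front from any position. The words occurring in the claim can then be paired so that each
  pair is a combination of terms \<open>d\<close> followed by a word of length two, and these cancel.
\<close>

lemma young311_young21_eq_0_real:
  fixes t :: "'k \<Rightarrow> 'k \<Rightarrow> 'k \<Rightarrow> 'k \<Rightarrow> 'k \<Rightarrow> real"
  assumes l: "\<And>X Y Z W V. t X Y Z W V + t X Z Y W V = t Y Z X W V + t Z Y X W V"
    and r: "\<And>X Y Z W V. t X Y Z W V + t X Y W Z V = t X Z W Y V + t X W Z Y V"
  shows "young311 (\<lambda>E D. young21 (t E D)) E D A B C = 0"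
proof -
  define d where "d X Y Z W V = t X Y Z W V + t Y X Z W V" for X Y Z W V
  have d3: "t Z W X Y V + t Z W Y X V = d X Y Z W V" for X Y Z W V
    using l[of Z X Y W V] r[of Z W X Y V] by (simp add: d_def)
  \<comment> \<open>\<open>YZW + WZY = d(Y,Z) W - Z (YW + WY) + d(Z,W) Y\<close>, preceded by \<open>X\<close>.\<close>
  have K1: "t X Y Z W V + t X W Z Y V = d Y Z X W V + d Z W X Y V - d Y W X Z V" for X Y Z W V
    using l[of X Y Z W V] l[of X Z W Y V] r[of X Z Y W V] l[of X Y W Z V] by (simp add: d_def)
  \<comment> \<open>Interchanging \<open>X\<close> with the first letter reduces this pairing to the previous one.\<close>
  have K2: "t Y X Z W V + t W X Z Y V
    = d X Y Z W V + d X W Z Y V - (d Y Z X W V + d Z W X Y V - d Y W X Z V)" for X Y Z W V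
    using K1[of X Y Z W V] by (simp add: d_def)
  have dc: "d X Y Z W V = d Y X Z W V" for X Y Z W V by (simp add: d_def)
  have d1: "t B C Z W V + t C B Z W V = d B C Z W V" "t D C Z W V + t C D Z W V = d D C Z W V"
    "t D B Z W V + t B D Z W V = d D B Z W V" for Z W V by (simp_all add: d_def)
  have p: "A1 + A2 = a \<Longrightarrow> A1 = a - A2" for A1 A2 a :: real by simp
  \<comment> \<open>One word of each pair is eliminated; the claim is symmetric in \<open>D, B, C\<close> and skew in \<open>E, A\<close>, so the
    pairs interchange two of \<open>D, B, C\<close>.\<close>
  note pairs =
    K1[of E D A B C, THEN p] K1[of E D A C B, THEN p] K1[of E B A C D, THEN p]
    K1[of A D E B C, THEN p] K1[of A D E C B, THEN p] K1[of A B E C D, THEN p]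
    K2[of D E A B C, THEN p] K2[of D E A C B, THEN p] K2[of B E A C D, THEN p]
    K2[of D A E B C, THEN p] K2[of D A E C B, THEN p] K2[of B A E C D, THEN p]
    d3[of E D B C A, THEN p] d3[of E B D C A, THEN p] d3[of E C D B A, THEN p]
    d3[of A D B C E, THEN p] d3[of A B D C E, THEN p] d3[of A C D B E, THEN p]
    d3[of D E B C A, THEN p] d3[of B E D C A, THEN p] d3[of C E D B A, THEN p]
    d3[of D A B C E, THEN p] d3[of B A D C E, THEN p] d3[of C A D B E, THEN p]
    d1[THEN p]
  note order = dc[of A E] dc[of D A] dc[of D E] dc[of B A] dc[of B E]
    dc[of B D] dc[of C A] dc[of C E] dc[of C D] dc[of C B]
  show ?thesis
    by (simp add: young_defs) (simp add: pairs order field_simps)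
qed

text \<open>
  The combinations have real coefficients, so identities between them may be tested on coordinates.
\<close>

lemma young_inner:
  fixes b :: "'v::real_inner"
  shows "young22 (\<lambda>D A B C. t D A B C \<bullet> b) D A B C = young22 t D A B C \<bullet> b"
    "young311 (\<lambda>E D A B C. s E D A B C \<bullet> b) E D A B C = young311 s E D A B C \<bullet> b"
    "young21 (\<lambda>A B C. r A B C \<bullet> b) A B C = young21 r A B C \<bullet> b"
  by (simp_all add: young_defs inner_simps field_simps)

lemma young22_young21_eq_0:
  fixes t :: "'k \<Rightarrow> 'k \<Rightarrow> 'k \<Rightarrow> 'k \<Rightarrow> 'v::euclidean_space"
  assumes r: "\<And>X Y Z V. t X Y Z V + t X Z Y V = t Y Z X V + t Z Y X V"
  shows "young22 (\<lambda>D. young21 (t D)) D A B C = 0"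
proof (rule euclidean_eqI)
  fix b :: 'v
  have "young22 (\<lambda>D. young21 (\<lambda>A B C. t D A B C \<bullet> b)) D A B C = 0"
    using r [THEN arg_cong [where f = "\<lambda>v. v \<bullet> b"]]
    by (intro young22_young21_eq_0_real) (simp only: inner_add_left)
  then show "young22 (\<lambda>D. young21 (t D)) D A B C \<bullet> b = 0 \<bullet> b"
    by (simp add: young_inner(1,3) [symmetric])
qed

lemma young311_young21_eq_0:
  fixes t :: "'k \<Rightarrow> 'k \<Rightarrow> 'k \<Rightarrow> 'k \<Rightarrow> 'k \<Rightarrow> 'v::euclidean_space"
  assumes l: "\<And>X Y Z W V. t X Y Z W V + t X Z Y W V = t Y Z X W V + t Z Y X W V"
    and r: "\<And>X Y Z W V. t X Y Z W V + t X Y W Z V = t X Z W Y V + t X W Z Y V"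
  shows "young311 (\<lambda>E D. young21 (t E D)) E D A B C = 0"
proof (rule euclidean_eqI)
  fix b :: 'v
  have "young311 (\<lambda>E D. young21 (\<lambda>A B C. t E D A B C \<bullet> b)) E D A B C = 0"
    using l [THEN arg_cong [where f = "\<lambda>v. v \<bullet> b"]] r [THEN arg_cong [where f = "\<lambda>v. v \<bullet> b"]]
    by (intro young311_young21_eq_0_real) (simp_all only: inner_add_left)
  then show "young311 (\<lambda>E D. young21 (t E D)) E D A B C \<bullet> b = 0 \<bullet> b"
    by (simp add: young_inner(2,3) [symmetric])
qed

text \<open>
  \<open>Sym\<^sup>3 \<otimes> \<Lambda>\<^sup>2\<close> is the sum of the representations of \<open>GL(k)\<close> with Young diagrams \<open>(3,1,1)\<close> and
  \<open>(4,1)\<close>; the exchange identity says that the component in \<open>(4,1)\<close> vanishes. Write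
  \<open>t X Y A B C = \<nabla>\<^sub>X\<nabla>\<^sub>Y h\<^sub>A\<^sub>B\<^sub>C\<close>. After symmetrization over \<open>A, B, C, D\<close> the symmetries of \<open>h\<close> leave only
  anticommutators of two of these letters applied to components of \<open>h\<close> with first index \<open>E\<close>, and the
  three lines of \<open>young311\<close> contribute them in the proportion \<open>-1/2 : -1/4 : 3/4\<close>.
\<close>

lemma young311_exchange:
  fixes t :: "'k \<Rightarrow> 'k \<Rightarrow> 'k \<Rightarrow> 'k \<Rightarrow> 'k \<Rightarrow> 'v::euclidean_space"
  assumes s: "\<And>X Y A B C. t X Y A B C = t X Y A C B"
    and c: "\<And>X Y A B C. t X Y A B C + t X Y B C A + t X Y C A B = 0"
  shows "young311 t E D A B C + young311 t E A D B C + young311 t E D B A C + young311 t E D C B A = 0"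
proof (rule euclidean_eqI)
  fix b :: 'v
  define u where "u X Y A B C = t X Y A B C \<bullet> b" for X Y A B C
  have s': "u X Y A B C = u X Y A C B" for X Y A B C
    unfolding u_def using s by simp
  have c': "u X Y A B C + u X Y B C A + u X Y C A B = 0" for X Y A B C
    unfolding u_def using c by (simp flip: inner_add_left)
  have k: "u X Y A B C = - u X Y B C A - u X Y C A B" for X Y A B C
    using c'[of X Y A B C] by simp
  \<comment> \<open>Normal form: the last two letters in alphabetical order, and the first of the last three not the
    smallest of them.\<close>
  note kk = k[of _ _ A B C] k[of _ _ A B E] k[of _ _ A C E] k[of _ _ B C E]
     k[of _ _ A B D] k[of _ _ A C D] k[of _ _ B C D] k[of _ _ A D E]  k[of _ _ B D E]  k[of _ _ C D E]
  note ss = s'[of _ _ _ B A] s'[of _ _ _ C A] s'[of _ _ _ D A] s'[of _ _ _ E A] s'[of _ _ _ C B]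
   s'[of _ _ _ D B] s'[of _ _ _ E B] s'[of _ _ _ D C] s'[of _ _ _ E C] s'[of _ _ _ E D]
  have "young311 u E D A B C + young311 u E A D B C + young311 u E D B A C + young311 u E D C B A = 0"
    by (simp add: young_defs ss kk field_simps)
  then show "(young311 t E D A B C + young311 t E A D B C + young311 t E D B A C + young311 t E D C B A) \<bullet> b
     = 0 \<bullet> b"
    unfolding u_def by (simp add: inner_add_left young_inner)
qed

section \<open>The target spaces as spaces of tensors with symmetries\<close>

text \<open>
  The map \<open>C21\<close> acts as the identity on the tensors with the stated symmetries, and its values have them.
\<close>

lemma V210_iff:
  "h \<in> V210 \<longleftrightarrow> (\<forall>A B C. h $ (A, B, C) = h $ (A, C, B)
      \<and> h $ (A, B, C) + h $ (B, C, A) + h $ (C, A, B) = 0)"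
  (is "_ \<longleftrightarrow> ?R h")
proof
  assume "h \<in> V210"
  then show "?R h"
    by (auto simp: V210_def C21_def young_defs scaleR_conv_of_real field_simps)
next
  assume R: "?R h"
  have "C21 h $ (A, B, C) = h $ (A, B, C)" for A B C
  proof -
    have 1: "h $ (A, C, B) = h $ (A, B, C)" "h $ (C, B, A) = h $ (C, A, B)" "h $ (B, A, C) = h $ (B, C, A)"
      using R by metis+
    have "h $ (A, B, C) + h $ (B, C, A) + h $ (C, A, B) = 0"
      using R by blast
    then have 2: "h $ (A, B, C) = - h $ (B, C, A) - h $ (C, A, B)"
      by algebra
    show ?thesis
      by (simp add: C21_def young_defs 1 2 scaleR_conv_of_real field_simps)
  qed
  then have "C21 h = h"
    by (simp add: vec_eq_iff)
  then show "h \<in> V210"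
    unfolding V210_def by (metis rangeI)
qed

text \<open>
  Under these symmetries the six terms of the skewsymmetrization over \<open>E, A, C\<close> are
  twice the three with cyclically permuted letters, which leaves a factor \<open>1/3\<close>. In the sum over the
  permutations of \<open>D, B, C\<close> the unpermuted one of the three contributes \<open>6\<close> times the tensor and, by the
  exchange identity, each of the other two contributes \<open>2\<close> times the tensor; \<open>3/10\<close> normalizes the total to \<open>1\<close>.
\<close>

lemma V3110I:
  assumes s1: "\<And>E D A B C. h $ (E, D, A, B, C) = h $ (E, B, A, D, C)"
    and s2: "\<And>E D A B C. h $ (E, D, A, B, C) = h $ (E, D, A, C, B)"
    and a: "\<And>E D A B C. h $ (E, D, A, B, C) = - h $ (A, D, E, B, C)"
    and x: "\<And>E D A B C. h $ (E, D, A, B, C) + h $ (E, A, D, B, C)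
               + h $ (E, D, B, A, C) + h $ (E, D, C, B, A) = 0"
  shows "h \<in> V3110"
proof -
  have "C311 h $ (E, D, A, B, C) = h $ (E, D, A, B, C)" for E D A B C
  proof -
    define u where "u X Y P Q R = h $ (X, P, Y, Q, R)" for X Y P Q R
    have s1': "u X Y P Q R = u X Y Q P R" and s2': "u X Y P Q R = u X Y P R Q"
      and a': "u X Y P Q R = - u Y X P Q R" for X Y P Q R
      using s1 s2 a unfolding u_def by blast+
    have x': "u X Y P Q R + u X P Y Q R + u X Q P Y R + u X R P Q Y = 0" for X Y P Q R
      using x[of X P Y Q R] by (simp add: u_def)
    \<comment> \<open>These instances bring each symmetric or skew group of letters into the order \<open>E, A, B, C, D\<close>.\<close>
    note perms =
      s1'[of _ _ A E] s1'[of _ _ B E] s1'[of _ _ C E] s1'[of _ _ D E] s1'[of _ _ B A]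
      s1'[of _ _ C A] s1'[of _ _ D A] s1'[of _ _ C B] s1'[of _ _ D B] s1'[of _ _ D C]
      s2'[of _ _ _ A E] s2'[of _ _ _ B E] s2'[of _ _ _ C E] s2'[of _ _ _ D E] s2'[of _ _ _ B A]
      s2'[of _ _ _ C A] s2'[of _ _ _ D A] s2'[of _ _ _ C B] s2'[of _ _ _ D B] s2'[of _ _ _ D C]
      a'[of A E] a'[of B E] a'[of C E] a'[of D E] a'[of B A]
      a'[of C A] a'[of D A] a'[of C B] a'[of D B] a'[of D C]
    have solve: "d = - a - b - c" if "a + b + c + d = 0" for a b c d :: complex
      using that by algebra
    have "u E A B C D + u E B A C D + u E C A B D + u E D A B C = 0"
      using x'[of E A D B C] by (simp add: perms algebra_simps)
    note x1 = solve[OF this]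
    have "- u E A B C D + u A B E C D + u A C E B D + u A D E B C = 0"
      using x'[of A E D B C] by (simp add: perms algebra_simps)
    note x2 = solve[OF this]
    have "(3/10) *\<^sub>R symsum3 (\<lambda>D B C. alt3 (\<lambda>E A C. u E A D B C) E A C) D B C = u E A D B C"
      by (simp add: young_defs perms x1 x2 scaleR_conv_of_real field_simps)
    then show ?thesis by (simp add: u_def C311_def)
  qed
  then have "C311 h = h"
    by (simp add: vec_eq_iff)
  then show "h \<in> V3110"
    unfolding V3110_def by (metis rangeI)
qed

text \<open>
  A tensor is the sum of its spinor coordinates times the standard basis vectors of \<open>\<complex>\<^sup>s\<close>, so membership
  in \<open>V \<otimes> \<complex>\<^sup>s\<close> can be tested on spinor coordinates.
\<close>

lemma tensor_spinorI:
  fixes h :: "complex^'s::finite^'i::finite"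
  assumes "\<And>s. (\<chi> i. h $ i $ s) \<in> V"
  shows "h \<in> tensor_spinor V"
proof -
  obtain f :: "nat \<Rightarrow> 's" where f: "bij_betw f {..<CARD('s)} UNIV"
    using ex_bij_betw_nat_finite[OF finite, of "UNIV :: 's set"] by (auto simp: atLeast0LessThan)
  have "h = (\<Sum>l<CARD('s). simple_tensor (\<chi> i. h $ i $ f l) (axis (f l) 1))"
  proof -
    have "(\<Sum>l<CARD('s). simple_tensor (\<chi> i. h $ i $ f l) (axis (f l) 1))
        = (\<Sum>t\<in>UNIV. simple_tensor (\<chi> i. h $ i $ t) (axis t 1))"
      by (rule sum.reindex_bij_betw[OF f])
    also have "\<dots> = h"
      by (simp add: vec_eq_iff simple_tensor_def axis_def if_distrib cong: if_cong)
    finally show ?thesis by simp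
  qed
  moreover have "\<forall>l<CARD('s). (\<chi> i. h $ i $ f l) \<in> V"
    using assms by blast
  ultimately show ?thesis
    unfolding tensor_spinor_def mem_Collect_eq
    by (intro exI[of _ "CARD('s)"] exI[of _ "\<lambda>l. \<chi> i. h $ i $ f l"] exI[of _ "\<lambda>l. axis (f l) 1"] conjI)
qed

lemma tensor_spinorD:
  assumes "vec.subspace V" "h \<in> tensor_spinor V"
  shows "(\<chi> i. h $ i $ s) \<in> V"
proof -
  obtain N :: nat and v w where v: "\<forall>l<N. v l \<in> V" and h: "h = (\<Sum>l<N. simple_tensor (v l) (w l))"
    using assms(2) unfolding tensor_spinor_def by blast
  have "(\<chi> i. h $ i $ s) = (\<Sum>l<N. (w l $ s) *s v l)"
    by (simp add: h vec_eq_iff simple_tensor_def mult.commute)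
  also have "\<dots> \<in> V"
    using v by (intro vec.subspace_sum[OF assms(1)] vec.subspace_scale[OF assms(1)]) auto
  finally show ?thesis .
qed

lemma subspace_V210: "vec.subspace (V210 :: (complex^('k::finite \<times> 'k \<times> 'k)) set)"
proof (rule vec.subspaceI)
  fix x y :: "complex^('k \<times> 'k \<times> 'k)"
  assume *: "x \<in> V210" "y \<in> V210"
  have "(x + y) $ (A, B, C) + (x + y) $ (B, C, A) + (x + y) $ (C, A, B) = 0" for A B C
  proof -
    have "(x + y) $ (A, B, C) + (x + y) $ (B, C, A) + (x + y) $ (C, A, B)
      = (x $ (A, B, C) + x $ (B, C, A) + x $ (C, A, B)) + (y $ (A, B, C) + y $ (B, C, A) + y $ (C, A, B))"
      by simp
    also have "\<dots> = 0 + 0"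
      using * unfolding V210_iff by (intro arg_cong2[of _ _ _ _ "(+)"]) blast+
    finally show ?thesis by simp
  qed
  moreover have "(x + y) $ (A, B, C) = (x + y) $ (A, C, B)" for A B C
    using * unfolding V210_iff vector_add_component by (intro arg_cong2[of _ _ _ _ "(+)"]) blast+
  ultimately show "x + y \<in> V210"
    unfolding V210_iff by blast
next
  fix c and x :: "complex^('k \<times> 'k \<times> 'k)"
  assume "x \<in> V210"
  then have 1: "x $ (A, B, C) = x $ (A, C, B)"
    and 2: "x $ (A, B, C) + x $ (B, C, A) + x $ (C, A, B) = 0" for A B C
    unfolding V210_iff by blast+
  have "c * x $ (A, B, C) + c * x $ (B, C, A) + c * x $ (C, A, B) = 0" for A B C
    using 2[of A B C] by (simp flip: distrib_left)
  then show "c *s x \<in> V210"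
    unfolding V210_iff vector_smult_component using 1 by metis
qed (simp add: V210_iff)

lemma V2_iff:
  "h \<in> V2 \<longleftrightarrow> (\<forall>A B C. h $ (A, B, C) = h $ (A, C, B)
      \<and> h $ (A, B, C) + h $ (B, C, A) + h $ (C, A, B) = 0)"
proof -
  have "h \<in> V2 \<longleftrightarrow> (\<forall>s. (\<chi> i. h $ i $ s) \<in> V210)"
    unfolding V2_def using tensor_spinorI tensor_spinorD[OF subspace_V210] by blast
  then show ?thesis
    unfolding V210_iff vec_eq_iff vec_lambda_beta vector_add_component zero_index by blast
qed

lemma V1_eq_UNIV: "V1 = UNIV"
  unfolding V1_def using tensor_spinorI by blast

lemma young21_in_V2:
  "vec_lambda (\<lambda>(A, B, C). young21 t A B C) \<in> V2"
  unfolding V2_iff by (simp add: young_defs vec_eq_iff field_simps)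

lemma young22_in_V3':
  "vec_lambda (\<lambda>(D, A, B, C). young22 t D A B C) \<in> V3'"
  unfolding V3'_def
proof (rule tensor_spinorI)
  fix s
  have "(\<chi> i. vec_lambda (\<lambda>(D, A, B, C). young22 t D A B C) $ i $ s)
      = C22 (vec_lambda (\<lambda>(D, A, B, C). 6 *\<^sub>R t D A B C $ s))"
    by (simp add: vec_eq_iff C22_def young_defs split_beta) (simp add: scaleR_conv_of_real field_simps)
  then show "(\<chi> i. vec_lambda (\<lambda>(D, A, B, C). young22 t D A B C) $ i $ s) \<in> V220"
    unfolding V220_def by simp
qed

text \<open>
  The symmetries in \<open>D, B, C\<close> and in \<open>E, A\<close> are built into \<open>young311\<close>; those of \<open>h \<in> V\<^sub>2\<close> enter through the exchange
  identity.
\<close>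

lemma young311_in_V3'':
  fixes t :: "'k::finite \<Rightarrow> 'k \<Rightarrow> 'k \<Rightarrow> 'k \<Rightarrow> 'k \<Rightarrow> complex^'m::finite"
  assumes s: "\<And>X Y A B C. t X Y A B C = t X Y A C B"
    and c: "\<And>X Y A B C. t X Y A B C + t X Y B C A + t X Y C A B = 0"
  shows "vec_lambda (\<lambda>(E, D, A, B, C). (1/2) *\<^sub>R young311 t E D A B C) \<in> V3''"
  unfolding V3''_def
proof (intro tensor_spinorI V3110I)
  fix s E D A B C
  let ?h = "\<chi> i. vec_lambda (\<lambda>(E, D, A, B, C). (1/2) *\<^sub>R young311 t E D A B C) $ i $ s"
  show "?h $ (E, D, A, B, C) = ?h $ (E, B, A, D, C)"
    by (simp add: young_defs add_ac)
  show "?h $ (E, D, A, B, C) = ?h $ (E, D, A, C, B)"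
    by (simp add: young_defs add_ac)
  show "?h $ (E, D, A, B, C) = - ?h $ (A, D, E, B, C)"
    by (simp add: young_defs scaleR_conv_of_real field_simps)
  have "(1/2) *\<^sub>R (young311 t E D A B C + young311 t E A D B C
      + young311 t E D B A C + young311 t E D C B A) $ s = 0"
    using young311_exchange[of t, OF s c] by (simp flip: vector_add_component)
  then show "?h $ (E, D, A, B, C) + ?h $ (E, A, D, B, C) + ?h $ (E, D, B, A, C) + ?h $ (E, D, C, B, A) = 0"
    by (simp add: scaleR_add_right)
qed

section \<open>Smooth functions and the symmetry of second derivatives\<close>

abbreviation dir_deriv :: "'a::real_normed_vector \<Rightarrow> ('a \<Rightarrow> 'b::real_normed_vector) \<Rightarrow> 'a \<Rightarrow> 'b" where
  "dir_deriv v f x \<equiv> frechet_derivative f (at x) v"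

lemma has_real_derivative_along_line:
  fixes f :: "'a::real_normed_vector \<Rightarrow> real"
  assumes "f differentiable at (x + s *\<^sub>R u)"
  shows "((\<lambda>s. f (x + s *\<^sub>R u)) has_real_derivative dir_deriv u f (x + s *\<^sub>R u)) (at s)"
proof -
  let ?D = "frechet_derivative f (at (x + s *\<^sub>R u))"
  have 1: "(f has_derivative ?D) (at (x + s *\<^sub>R u))"
    using assms by (simp add: frechet_derivative_works)
  have 2: "((\<lambda>s. x + s *\<^sub>R u) has_derivative (\<lambda>h. h *\<^sub>R u)) (at s)"
    by (auto intro!: derivative_eq_intros)
  have "((\<lambda>s. f (x + s *\<^sub>R u)) has_derivative (\<lambda>h. ?D (h *\<^sub>R u))) (at s)"
    using has_derivative_compose[OF 2 1] .
  moreover have "(\<lambda>h. ?D (h *\<^sub>R u)) = (*) (?D u)"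
    using linear_frechet_derivative[OF assms] by (auto simp: linear_cmul)
  ultimately show ?thesis
    by (simp add: has_field_derivative_def)
qed

text \<open>
  The mean value theorem in direction \<open>u\<close> for the difference in direction \<open>v\<close>, then in direction \<open>v\<close>.
\<close>

lemma second_difference_mvt:
  fixes f :: "'a::real_normed_vector \<Rightarrow> real"
  assumes h: "h > 0"
    and f: "\<And>s t. \<lbrakk>0 \<le> s; s \<le> h; 0 \<le> t; t \<le> h\<rbrakk> \<Longrightarrow> f differentiable at (x + s *\<^sub>R u + t *\<^sub>R v)"
    and f': "\<And>s t. \<lbrakk>0 \<le> s; s \<le> h; 0 \<le> t; t \<le> h\<rbrakk>
      \<Longrightarrow> dir_deriv u f differentiable at (x + s *\<^sub>R u + t *\<^sub>R v)"
  obtains s t where "0 \<le> s" "s \<le> h" "0 \<le> t" "t \<le> h"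
    "f (x + h *\<^sub>R u + h *\<^sub>R v) - f (x + h *\<^sub>R u) - f (x + h *\<^sub>R v) + f x
       = h * h * dir_deriv v (dir_deriv u f) (x + s *\<^sub>R u + t *\<^sub>R v)"
proof -
  have D: "((\<lambda>s. f (x + s *\<^sub>R u + t *\<^sub>R v)) has_real_derivative dir_deriv u f (x + s *\<^sub>R u + t *\<^sub>R v)) (at s)"
    if "0 \<le> s" "s \<le> h" "0 \<le> t" "t \<le> h" for s t
    using has_real_derivative_along_line[of f "x + t *\<^sub>R v" s u] f[OF that]
    by (simp add: add_ac)
  have "\<exists>s>0. s < h \<and> (f (x + h *\<^sub>R u + h *\<^sub>R v) - f (x + h *\<^sub>R u + 0 *\<^sub>R v))
      - (f (x + 0 *\<^sub>R u + h *\<^sub>R v) - f (x + 0 *\<^sub>R u + 0 *\<^sub>R v))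
     = (h - 0) * (dir_deriv u f (x + s *\<^sub>R u + h *\<^sub>R v) - dir_deriv u f (x + s *\<^sub>R u + 0 *\<^sub>R v))"
    by (rule MVT2[of 0 h "\<lambda>s. f (x + s *\<^sub>R u + h *\<^sub>R v) - f (x + s *\<^sub>R u + 0 *\<^sub>R v)"])
       (use h in \<open>auto intro!: DERIV_diff D simp del: scaleR_zero_left\<close>)
  then obtain s where s: "0 < s" "s < h" and
    1: "f (x + h *\<^sub>R u + h *\<^sub>R v) - f (x + h *\<^sub>R u) - f (x + h *\<^sub>R v) + f x
     = h * (dir_deriv u f (x + s *\<^sub>R u + h *\<^sub>R v) - dir_deriv u f (x + s *\<^sub>R u + 0 *\<^sub>R v))"
    by auto
  have "\<exists>t>0. t < h \<and> dir_deriv u f (x + s *\<^sub>R u + h *\<^sub>R v) - dir_deriv u f (x + s *\<^sub>R u + 0 *\<^sub>R v)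
      = (h - 0) * dir_deriv v (dir_deriv u f) (x + s *\<^sub>R u + t *\<^sub>R v)"
    by (rule MVT2) (use h s in \<open>auto intro!: has_real_derivative_along_line f'\<close>)
  then obtain t where t: "0 < t" "t < h" and
    2: "dir_deriv u f (x + s *\<^sub>R u + h *\<^sub>R v) - dir_deriv u f (x + s *\<^sub>R u + 0 *\<^sub>R v)
      = h * dir_deriv v (dir_deriv u f) (x + s *\<^sub>R u + t *\<^sub>R v)"
    by auto
  show thesis
    by (rule that[of s t]) (use s t 1 2 in auto)
qed

text \<open>
  The second difference over a small parallelogram is symmetric in \<open>u\<close> and \<open>v\<close>, and by the mean value
  theorem it equals both mixed derivatives at nearby points, up to the same factor. If the mixed derivatives at \<open>x\<close>
  differed, continuity would keep them apart on a neighbourhood.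
\<close>

lemma dir_deriv_commute_real:
  fixes f :: "'a::real_normed_vector \<Rightarrow> real"
  assumes S: "open S" "x \<in> S"
    and f: "f differentiable_on S" "dir_deriv u f differentiable_on S" "dir_deriv v f differentiable_on S"
    and c: "continuous_on S (dir_deriv v (dir_deriv u f))" "continuous_on S (dir_deriv u (dir_deriv v f))"
  shows "dir_deriv v (dir_deriv u f) x = dir_deriv u (dir_deriv v f) x"
proof (rule ccontr)
  assume ne: "\<not> ?thesis"
  define e where "e = \<bar>dir_deriv v (dir_deriv u f) x - dir_deriv u (dir_deriv v f) x\<bar> / 2"
  have e: "e > 0" using ne by (simp add: e_def)
  have at: "g differentiable at y" if "g differentiable_on S" "y \<in> S" for g :: "'a \<Rightarrow> real" and y
    using that S by (meson differentiable_on_eq_differentiable_at)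
  obtain d0 where d0: "d0 > 0" "ball x d0 \<subseteq> S"
    using S by (meson open_contains_ball)
  obtain d1 where d1: "d1 > 0"
      "\<And>y. y \<in> S \<Longrightarrow> dist y x < d1 \<Longrightarrow> dist (dir_deriv v (dir_deriv u f) y) (dir_deriv v (dir_deriv u f) x) < e"
    using c(1) S e unfolding continuous_on_iff by metis
  obtain d2 where d2: "d2 > 0"
      "\<And>y. y \<in> S \<Longrightarrow> dist y x < d2 \<Longrightarrow> dist (dir_deriv u (dir_deriv v f) y) (dir_deriv u (dir_deriv v f) x) < e"
    using c(2) S e unfolding continuous_on_iff by metis
  \<comment> \<open>The parallelogram with sides \<open>h u\<close> and \<open>h v\<close> at \<open>x\<close> lies in the ball of radius \<open>d\<close>; the summand \<open>1\<close>
    avoids division by zero.\<close>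
  define d where "d = min d0 (min d1 d2)"
  define h where "h = d / (2 * (norm u + norm v + 1))"
  have n: "norm u + norm v + 1 > 0"
    using norm_ge_zero[of u] norm_ge_zero[of v] by linarith
  have d: "d > 0" using d0 d1 d2 by (simp add: d_def)
  have h: "h > 0" using d n by (simp add: h_def)
  have near: "dist (x + s *\<^sub>R u + t *\<^sub>R v) x < d" if "0 \<le> s" "s \<le> h" "0 \<le> t" "t \<le> h" for s t
  proof -
    have "dist (x + s *\<^sub>R u + t *\<^sub>R v) x = norm (s *\<^sub>R u + t *\<^sub>R v)"
      by (simp add: dist_norm add.assoc)
    also have "\<dots> \<le> s * norm u + t * norm v"
      using that norm_triangle_ineq[of "s *\<^sub>R u" "t *\<^sub>R v"] by simp
    also have "\<dots> \<le> h * norm u + h * norm v"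
      using that by (intro add_mono mult_right_mono) auto
    also have "\<dots> \<le> h * (norm u + norm v + 1)"
      using h by (simp add: algebra_simps)
    also have "\<dots> = d / 2"
      using n by (simp add: h_def field_simps)
    also have "\<dots> < d" using d by simp
    finally show ?thesis .
  qed
  have inS: "y \<in> S" if "dist y x < d" for y
    using that d0 by (auto simp: d_def dist_commute)
  obtain s t where st: "0 \<le> s" "s \<le> h" "0 \<le> t" "t \<le> h" and
    1: "f (x + h *\<^sub>R u + h *\<^sub>R v) - f (x + h *\<^sub>R u) - f (x + h *\<^sub>R v) + f x
       = h * h * dir_deriv v (dir_deriv u f) (x + s *\<^sub>R u + t *\<^sub>R v)"
    by (rule second_difference_mvt[of h f x u v]) (use h f in \<open>auto intro!: at inS near\<close>)
  have near': "dist (x + s *\<^sub>R v + t *\<^sub>R u) x < d" if "0 \<le> s" "s \<le> h" "0 \<le> t" "t \<le> h" for s t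
    using near[of t s] that by (simp add: add_ac)
  obtain s' t' where st': "0 \<le> s'" "s' \<le> h" "0 \<le> t'" "t' \<le> h" and
    2: "f (x + h *\<^sub>R v + h *\<^sub>R u) - f (x + h *\<^sub>R v) - f (x + h *\<^sub>R u) + f x
       = h * h * dir_deriv u (dir_deriv v f) (x + s' *\<^sub>R v + t' *\<^sub>R u)"
    by (rule second_difference_mvt[of h f x v u]) (use h f in \<open>auto intro!: at inS near'\<close>)
  have "x + h *\<^sub>R v + h *\<^sub>R u = x + h *\<^sub>R u + h *\<^sub>R v" by (simp add: add_ac)
  with 1 2 h have "dir_deriv v (dir_deriv u f) (x + s *\<^sub>R u + t *\<^sub>R v) = dir_deriv u (dir_deriv v f) (x + s' *\<^sub>R v + t' *\<^sub>R u)"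
    by (simp add: algebra_simps)
  moreover have "dist (dir_deriv v (dir_deriv u f) (x + s *\<^sub>R u + t *\<^sub>R v)) (dir_deriv v (dir_deriv u f) x) < e"
    using d1(2) near[OF st] inS by (auto simp: d_def)
  moreover have "dist (dir_deriv u (dir_deriv v f) (x + s' *\<^sub>R v + t' *\<^sub>R u)) (dir_deriv u (dir_deriv v f) x) < e"
    using d2(2) near'[OF st'] inS by (auto simp: d_def)
  ultimately show False
    unfolding e_def dist_real_def by (auto simp: abs_if field_simps split: if_splits)
qed

lemma dir_deriv_cong:
  assumes "open S" "x \<in> S" "\<And>y. y \<in> S \<Longrightarrow> f y = g y"
  shows "dir_deriv v f x = dir_deriv v g x"
proof -
  have "(f has_derivative f') (at x) \<longleftrightarrow> (g has_derivative f') (at x)" for f'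
    using has_derivative_transform_within_open[OF _ assms(1,2), of f f' UNIV g]
      has_derivative_transform_within_open[OF _ assms(1,2), of g f' UNIV f] assms(3) by auto
  then show ?thesis
    unfolding frechet_derivative_def by simp
qed

lemma differentiable_on_open_cong:
  assumes "open S" "\<And>y. y \<in> S \<Longrightarrow> f y = g y" "f differentiable_on S"
  shows "g differentiable_on S"
  unfolding differentiable_on_def
  using assms by (metis differentiable_on_def differentiable_transform_within zero_less_one)

lemma Ck_on_cong:
  assumes "open S" "\<And>y. y \<in> S \<Longrightarrow> f y = g y" "Ck_on m f S"
  shows "Ck_on m g S"
  using assms(2,3)
proof (induction m arbitrary: f g)
  case 0
  then show ?case by (metis Ck_on.simps(1) continuous_on_eq)
next
  case (Suc m)
  have "Ck_on m (dir_deriv v g) S" if "v \<in> Basis" for v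
    using Suc.IH[of "dir_deriv v f" "dir_deriv v g"] dir_deriv_cong[OF assms(1)] Suc.prems that by auto
  then show ?case
    using differentiable_on_open_cong[OF assms(1)] Suc.prems by auto
qed

lemma dir_deriv_linear_compose:
  assumes "bounded_linear L" "f differentiable at x"
  shows "dir_deriv v (\<lambda>y. L (f y)) x = L (dir_deriv v f x)"
proof -
  have "(f has_derivative frechet_derivative f (at x)) (at x)"
    using assms by (simp add: frechet_derivative_works)
  then have "((\<lambda>y. L (f y)) has_derivative (\<lambda>v. L (frechet_derivative f (at x) v))) (at x)"
    using assms(1) by (rule bounded_linear.has_derivative[rotated])
  then show ?thesis
    by (metis frechet_derivative_at)
qed

lemma dir_deriv_add:
  assumes "f differentiable at x" "g differentiable at x"
  shows "dir_deriv v (\<lambda>y. f y + g y) x = dir_deriv v f x + dir_deriv v g x"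
proof -
  have "((\<lambda>y. f y + g y) has_derivative
      (\<lambda>v. frechet_derivative f (at x) v + frechet_derivative g (at x) v)) (at x)"
    using assms by (intro has_derivative_add) (simp_all add: frechet_derivative_works)
  then show ?thesis
    by (metis frechet_derivative_at)
qed

lemma differentiable_on_at: "\<lbrakk>f differentiable_on S; open S; x \<in> S\<rbrakk> \<Longrightarrow> f differentiable at x"
  by (meson differentiable_on_eq_differentiable_at)

lemma Ck_on_linear_compose:
  assumes "open S" "bounded_linear L" "Ck_on m f S"
  shows "Ck_on m (\<lambda>x. L (f x)) S"
  using assms(3)
proof (induction m arbitrary: f)
  case 0
  then show ?case using assms(2) by (simp add: bounded_linear.continuous_on)
next
  case (Suc m)
  have "Ck_on m (dir_deriv v (\<lambda>x. L (f x))) S" if "v \<in> Basis" for v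
    by (rule Ck_on_cong[OF assms(1) _ Suc.IH[of "dir_deriv v f"]])
       (use Suc.prems that assms in \<open>auto simp: dir_deriv_linear_compose differentiable_on_at\<close>)
  moreover have "(\<lambda>x. L (f x)) differentiable_on S"
    unfolding differentiable_on_def
  proof
    fix x assume "x \<in> S"
    then obtain D where "(f has_derivative D) (at x within S)"
      using Suc.prems by (auto simp: differentiable_on_def differentiable_def)
    then show "(\<lambda>x. L (f x)) differentiable (at x within S)"
      using bounded_linear.has_derivative[OF assms(2)] unfolding differentiable_def by blast
  qed
  ultimately show ?case by simp
qed

lemma Ck_on_add:
  assumes "open S" "Ck_on m f S" "Ck_on m g S"
  shows "Ck_on m (\<lambda>x. f x + g x) S"
  using assms(2,3)
proof (induction m arbitrary: f g)
  case 0
  then show ?case by (simp add: continuous_on_add)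
next
  case (Suc m)
  have "Ck_on m (dir_deriv v (\<lambda>x. f x + g x)) S" if "v \<in> Basis" for v
    by (rule Ck_on_cong[OF assms(1) _ Suc.IH[of "dir_deriv v f" "dir_deriv v g"]])
       (use Suc.prems that assms in \<open>auto simp: dir_deriv_add differentiable_on_at\<close>)
  moreover have "(\<lambda>x. f x + g x) differentiable_on S"
    using Suc.prems by simp
  ultimately show ?case by simp
qed

lemma Ck_on_zero: "Ck_on m (\<lambda>x. 0) S"
  by (induction m) (auto simp: differentiable_on_def)

lemma smooth_on_linear_compose:
  "\<lbrakk>open S; bounded_linear L; smooth_on f S\<rbrakk> \<Longrightarrow> smooth_on (\<lambda>x. L (f x)) S"
  unfolding smooth_on_def by (blast intro: Ck_on_linear_compose)

lemma smooth_on_add: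
  "\<lbrakk>open S; smooth_on f S; smooth_on g S\<rbrakk> \<Longrightarrow> smooth_on (\<lambda>x. f x + g x) S"
  unfolding smooth_on_def by (blast intro: Ck_on_add)

lemma smooth_on_sum:
  "\<lbrakk>open S; \<And>i. i \<in> I \<Longrightarrow> smooth_on (f i) S\<rbrakk> \<Longrightarrow> smooth_on (\<lambda>x. \<Sum>i\<in>I. f i x) S"
  by (induction I rule: infinite_finite_induct)
     (simp_all add: smooth_on_add, simp_all add: smooth_on_def Ck_on_zero)

lemma smooth_on_scaleR:
  "\<lbrakk>open S; smooth_on f S\<rbrakk> \<Longrightarrow> smooth_on (\<lambda>x. c *\<^sub>R f x) S"
  by (rule smooth_on_linear_compose[OF _ bounded_linear_scaleR_right])

lemma smooth_on_diff:
  "\<lbrakk>open S; smooth_on f S; smooth_on g S\<rbrakk> \<Longrightarrow> smooth_on (\<lambda>x. f x - g x) S"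
  using smooth_on_add[of S f "\<lambda>x. (-1) *\<^sub>R g x"] smooth_on_scaleR[of S g "-1"] by simp

lemma smooth_on_dir_deriv: "\<lbrakk>smooth_on f S; v \<in> Basis\<rbrakk> \<Longrightarrow> smooth_on (dir_deriv v f) S"
  unfolding smooth_on_def by (metis Ck_on.simps(2))

lemma smooth_on_imp_differentiable_on: "smooth_on f S \<Longrightarrow> f differentiable_on S"
  unfolding smooth_on_def by (metis Ck_on.simps(2))

lemma smooth_on_imp_differentiable_at: "\<lbrakk>smooth_on f S; open S; x \<in> S\<rbrakk> \<Longrightarrow> f differentiable at x"
  by (rule differentiable_on_at[OF smooth_on_imp_differentiable_on])

lemma smooth_on_imp_continuous_on: "smooth_on f S \<Longrightarrow> continuous_on S f"
  unfolding smooth_on_def by (metis Ck_on.simps(1))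

lemma smooth_on_vec_iff:
  fixes f :: "'a::euclidean_space \<Rightarrow> 'b::euclidean_space^'i::finite"
  assumes "open S"
  shows "smooth_on f S \<longleftrightarrow> (\<forall>i. smooth_on (\<lambda>x. f x $ i) S)"
proof (intro iffI allI)
  show "smooth_on (\<lambda>x. f x $ i) S" if "smooth_on f S" for i
    by (rule smooth_on_linear_compose[OF assms bounded_linear_vec_nth that])
next
  assume *: "\<forall>i. smooth_on (\<lambda>x. f x $ i) S"
  have bl: "bounded_linear (\<lambda>v::'b. axis i v :: 'b^'i)" for i
    by (simp flip: linear_conv_bounded_linear) (auto intro!: linearI simp: vec_eq_iff axis_def)
  have "f = (\<lambda>x. \<Sum>i\<in>UNIV. axis i (f x $ i))"
    by (auto simp: fun_eq_iff vec_eq_iff axis_def if_distrib cong: if_cong)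
  moreover have "smooth_on (\<lambda>x. \<Sum>i\<in>UNIV. axis i (f x $ i)) S"
    using * assms by (intro smooth_on_sum smooth_on_linear_compose[OF _ bl]) auto
  ultimately show "smooth_on f S" by simp
qed

lemma dir_deriv_commute:
  fixes f :: "'a::euclidean_space \<Rightarrow> 'b::euclidean_space"
  assumes S: "open S" "x \<in> S" and f: "smooth_on f S" and uv: "u \<in> Basis" "v \<in> Basis"
  shows "dir_deriv v (dir_deriv u f) x = dir_deriv u (dir_deriv v f) x"
proof (rule euclidean_eqI)
  fix b :: 'b
  define g where "g y = f y \<bullet> b" for y
  have bl: "bounded_linear (\<lambda>y::'b. y \<bullet> b)" by (rule bounded_linear_inner_left)
  have g: "smooth_on g S"
    unfolding g_def by (rule smooth_on_linear_compose[OF S(1) bl f])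
  have 1: "dir_deriv w g y = dir_deriv w f y \<bullet> b" if "y \<in> S" for w y
    unfolding g_def using dir_deriv_linear_compose[OF bl] f S that smooth_on_imp_differentiable_at by blast
  have 2: "dir_deriv w' (dir_deriv w g) x = dir_deriv w' (dir_deriv w f) x \<bullet> b" if "w \<in> Basis" for w w'
  proof -
    have "dir_deriv w' (dir_deriv w g) x = dir_deriv w' (\<lambda>y. dir_deriv w f y \<bullet> b) x"
      by (rule dir_deriv_cong[OF S]) (simp add: 1)
    also have "\<dots> = dir_deriv w' (dir_deriv w f) x \<bullet> b"
      by (rule dir_deriv_linear_compose[OF bl])
         (use f S that smooth_on_imp_differentiable_at smooth_on_dir_deriv in blast)
    finally show ?thesis .
  qed
  have "dir_deriv v (dir_deriv u g) x = dir_deriv u (dir_deriv v g) x"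
    by (rule dir_deriv_commute_real[OF S])
       (use g uv in \<open>auto intro: smooth_on_imp_differentiable_on smooth_on_imp_continuous_on smooth_on_dir_deriv\<close>)
  then show "dir_deriv v (dir_deriv u f) x \<bullet> b = dir_deriv u (dir_deriv v f) x \<bullet> b"
    using 2 uv by simp
qed

section \<open>Dirac operators and the Clifford relations\<close>

lemma pd_eq: "pd A j f = dir_deriv (axis A (axis j 1)) f"
  by (simp add: pd_def fun_eq_iff)

lemma smooth_on_pd: "smooth_on f S \<Longrightarrow> smooth_on (pd A j f) S"
  unfolding pd_eq by (rule smooth_on_dir_deriv) simp_all

lemma pd_cong:
  "\<lbrakk>open S; x \<in> S; \<And>y. y \<in> S \<Longrightarrow> f y = g y\<rbrakk> \<Longrightarrow> pd A j f x = pd A j g x"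
  unfolding pd_def by (rule dir_deriv_cong)

lemma pd_commute:
  fixes f :: "real^'n::finite^'k::finite \<Rightarrow> 'b::euclidean_space"
  shows "\<lbrakk>open S; x \<in> S; smooth_on f S\<rbrakk> \<Longrightarrow> pd A i (pd B j f) x = pd B j (pd A i f) x"
  unfolding pd_eq by (rule dir_deriv_commute) simp_all

lemma pd_linear_compose:
  "\<lbrakk>open S; x \<in> S; smooth_on f S; bounded_linear L\<rbrakk> \<Longrightarrow> pd A j (\<lambda>y. L (f y)) x = L (pd A j f x)"
  unfolding pd_def by (simp add: dir_deriv_linear_compose smooth_on_imp_differentiable_at)

lemma pd_add:
  "\<lbrakk>open S; x \<in> S; smooth_on f S; smooth_on g S\<rbrakk>
    \<Longrightarrow> pd A j (\<lambda>y. f y + g y) x = pd A j f x + pd A j g x"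
  unfolding pd_def by (simp add: dir_deriv_add smooth_on_imp_differentiable_at)

lemma pd_sum:
  assumes "open S" "x \<in> S" "\<And>i. i \<in> I \<Longrightarrow> smooth_on (f i) S"
  shows "pd A j (\<lambda>y. \<Sum>i\<in>I. f i y) x = (\<Sum>i\<in>I. pd A j (f i) x)"
  using assms(3)
proof (induction I rule: infinite_finite_induct)
  case (insert i I)
  then show ?case
    using assms(1,2) by (simp add: pd_add smooth_on_sum)
qed (simp_all add: pd_def)

lemma nabla_cong:
  "\<lbrakk>open S; x \<in> S; \<And>y. y \<in> S \<Longrightarrow> f y = f' y\<rbrakk> \<Longrightarrow> nabla g A f x = nabla g A f' x"
  unfolding nabla_def by (simp add: pd_cong[of S x f f'])

lemma smooth_on_matrix: 
  fixes M :: "complex^'a::finite^'b::finite"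
  shows "\<lbrakk>open S; smooth_on f S\<rbrakk> \<Longrightarrow> smooth_on (\<lambda>x. M *v f x) S"
  by (rule smooth_on_linear_compose) simp_all

lemma smooth_on_nabla:
  fixes g :: "'n::finite \<Rightarrow> complex^'a::finite^'b::finite"
  shows "\<lbrakk>open S; smooth_on f S\<rbrakk> \<Longrightarrow> smooth_on (nabla g A f) S"
  unfolding nabla_def by (intro smooth_on_sum smooth_on_matrix smooth_on_pd)

lemma nabla_add:
  fixes g :: "'n::finite \<Rightarrow> complex^'a::finite^'b::finite"
  assumes "open S" "x \<in> S" "smooth_on f S" "smooth_on f' S"
  shows "nabla g A (\<lambda>y. f y + f' y) x = nabla g A f x + nabla g A f' x"
  using assms by (simp add: nabla_def pd_add matrix_vector_right_distrib sum.distrib)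

lemma nabla_scaleR:
  fixes g :: "'n::finite \<Rightarrow> complex^'a::finite^'b::finite"
  assumes "open S" "x \<in> S" "smooth_on f S"
  shows "nabla g A (\<lambda>y. c *\<^sub>R f y) x = c *\<^sub>R nabla g A f x"
  using assms by (simp add: nabla_def pd_linear_compose[OF _ _ _ bounded_linear_scaleR_right]
      linear_cmul[OF matrix_vector_mul_linear] scaleR_sum_right)

lemma nabla_diff:
  fixes g :: "'n::finite \<Rightarrow> complex^'a::finite^'b::finite"
  assumes "open S" "x \<in> S" "smooth_on f S" "smooth_on f' S"
  shows "nabla g A (\<lambda>y. f y - f' y) x = nabla g A f x - nabla g A f' x"
  using nabla_add[OF assms(1-3), of "\<lambda>y. (-1) *\<^sub>R f' y" g A] nabla_scaleR[OF assms(1,2,4), of g A "-1"]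
    smooth_on_scaleR[OF assms(1,4), of "-1"] by simp

lemma nabla_nabla:
  fixes g' :: "'n::finite \<Rightarrow> complex^'a::finite^'b::finite" and g :: "'n \<Rightarrow> complex^'b^'c::finite"
  assumes "open S" "x \<in> S" "smooth_on f S"
  shows "nabla g B (nabla g' C f) x = (\<Sum>i\<in>UNIV. \<Sum>j\<in>UNIV. (g i ** g' j) *v pd B i (pd C j f) x)"
proof -
  have "pd B i (nabla g' C f) x = (\<Sum>j\<in>UNIV. g' j *v pd B i (pd C j f) x)" for i
    unfolding nabla_def using assms
    by (simp add: pd_sum smooth_on_matrix smooth_on_pd
        pd_linear_compose[OF _ _ _ matrix_vector_mul_bounded_linear])
  then show ?thesis
    by (simp add: nabla_def linear_sum[OF matrix_vector_mul_linear] matrix_vector_mul_assoc)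
qed

text \<open>
  The Clifford relations on one of the two summands of \<open>S\<^sup>+ \<oplus> S\<^sup>-\<close>; both are obtained by exchanging
  \<open>g\<close> and \<open>g'\<close>.
\<close>

definition clifford_pair :: "('n::finite \<Rightarrow> complex^'b^'a) \<Rightarrow> ('n \<Rightarrow> complex^'a^'b) \<Rightarrow> bool" where
  "clifford_pair g g' \<longleftrightarrow> (\<forall>i j. g i ** g' j + g j ** g' i = mat (if i = j then -2 else 0))"

lemma clifford_pairD:
  fixes g :: "'n::finite \<Rightarrow> complex^'b::finite^'a::finite"
  assumes "clifford_pair g g'"
  shows "(g i ** g' j) *v v + (g j ** g' i) *v v = (if i = j then - 2 *\<^sub>R v else 0)"
proof -
  have "(g i ** g' j) *v v + (g j ** g' i) *v v = mat (if i = j then -2 else 0) *v v"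
    using assms by (simp add: clifford_pair_def flip: matrix_vector_mult_add_rdistrib)
  also have "\<dots> = (if i = j then - 2 *\<^sub>R v else 0)"
    by (simp add: vec_eq_iff matrix_vector_mult_def mat_def if_distrib [of "\<lambda>x. x * _"] cong: if_cong)
       (simp add: scaleR_conv_of_real)
  finally show ?thesis .
qed

text \<open>
  The scalar operator \<open>\<Delta>\<^sub>B\<^sub>C\<close>, which makes sense for functions with values in any normed space.
\<close>

definition Lap :: "'k::finite \<Rightarrow> 'k \<Rightarrow>
    (real^'n::finite^'k \<Rightarrow> 'v::real_normed_vector) \<Rightarrow> real^'n^'k \<Rightarrow> 'v" where
  "Lap B C f x = (- 2) *\<^sub>R (\<Sum>j\<in>UNIV. pd B j (pd C j f) x)"

text \<open>
  After interchanging the partial derivatives and the summation indices in the second term, the coefficient of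
  \<open>\<partial>\<^sub>B\<^sub>i\<partial>\<^sub>C\<^sub>j f\<close> is the anticommutator of the \<open>i\<close>-th and \<open>j\<close>-th Clifford generators.
\<close>

lemma nabla_nabla_sym:
  fixes g :: "'n::finite \<Rightarrow> complex^'b::finite^'a::finite"
  assumes g: "clifford_pair g g'" and S: "open S" "x \<in> S" and f: "smooth_on f S"
  shows "nabla g B (nabla g' C f) x + nabla g C (nabla g' B f) x = Lap B C f x"
proof -
  have "nabla g C (nabla g' B f) x = (\<Sum>i\<in>UNIV. \<Sum>j\<in>UNIV. (g i ** g' j) *v pd B j (pd C i f) x)"
    unfolding nabla_nabla[OF S f] by (simp add: pd_commute[OF S f, of C _ B])
  also have "\<dots> = (\<Sum>i\<in>UNIV. \<Sum>j\<in>UNIV. (g j ** g' i) *v pd B i (pd C j f) x)"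
    by (rule sum.swap)
  finally have "nabla g B (nabla g' C f) x + nabla g C (nabla g' B f) x
     = (\<Sum>i\<in>UNIV. \<Sum>j\<in>UNIV. if i = j then - 2 *\<^sub>R pd B i (pd C j f) x else 0)"
    unfolding nabla_nabla[OF S f] by (simp only: clifford_pairD[OF g] flip: sum.distrib)
  then show ?thesis
    by (simp add: Lap_def scaleR_sum_right)
qed

lemma Lap_nabla:
  fixes g :: "'n::finite \<Rightarrow> complex^'a::finite^'b::finite"
  assumes S: "open S" "x \<in> S" and f: "smooth_on f S"
  shows "Lap B C (nabla g A f) x = nabla g A (Lap B C f) x"
proof -
  have 1: "pd C j (nabla g A f) y = (\<Sum>i\<in>UNIV. g i *v pd C j (pd A i f) y)" if "y \<in> S" for j y
    unfolding nabla_def using S that f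
    by (simp add: pd_sum smooth_on_matrix smooth_on_pd
        pd_linear_compose[OF _ _ _ matrix_vector_mul_bounded_linear])
  have c: "pd B j (pd C j (pd A i f)) x = pd A i (pd B j (pd C j f)) x" for i j
  proof -
    have "pd B j (pd C j (pd A i f)) x = pd B j (pd A i (pd C j f)) x"
      using S f by (intro pd_cong[OF S] pd_commute)
    then show ?thesis
      using pd_commute[OF S smooth_on_pd[OF f]] by metis
  qed
  have 2: "pd B j (pd C j (nabla g A f)) x = (\<Sum>i\<in>UNIV. g i *v pd A i (pd B j (pd C j f)) x)" for j
  proof -
    have "pd B j (pd C j (nabla g A f)) x = pd B j (\<lambda>y. \<Sum>i\<in>UNIV. g i *v pd C j (pd A i f) y) x"
      using S 1 by (rule pd_cong)
    also have "\<dots> = (\<Sum>i\<in>UNIV. g i *v pd B j (pd C j (pd A i f)) x)"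
      using S f by (simp add: pd_sum smooth_on_matrix smooth_on_pd
        pd_linear_compose[OF _ _ _ matrix_vector_mul_bounded_linear])
    finally show ?thesis by (simp only: c)
  qed
  have 3: "pd A i (Lap B C f) x = - 2 *\<^sub>R (\<Sum>j\<in>UNIV. pd A i (pd B j (pd C j f)) x)" for i
    unfolding Lap_def using S f
    by (simp add: pd_linear_compose[OF _ _ _ bounded_linear_scaleR_right] pd_linear_compose[OF _ _ _ bounded_linear_minus[OF bounded_linear_ident]]
         smooth_on_sum smooth_on_scaleR smooth_on_pd pd_sum)
  show ?thesis
    unfolding nabla_def[of g A "Lap B C f"] 3 unfolding Lap_def 2
    by (simp add: linear_cmul[OF matrix_vector_mul_linear] linear_sum[OF matrix_vector_mul_linear]
       linear_neg[OF matrix_vector_mul_linear] scaleR_sum_right) (rule sum.swap)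
qed

text \<open>
  Both sides are \<open>\<nabla>\<^sub>X \<Delta>\<^sub>Y\<^sub>Z f = \<Delta>\<^sub>Y\<^sub>Z \<nabla>\<^sub>X f\<close>, with \<open>\<Delta>\<^sub>Y\<^sub>Z\<close> acting on spinors of the two different parities.
\<close>

lemma nabla3_relation:
  fixes g :: "'n::finite \<Rightarrow> complex^'b::finite^'a::finite"
  assumes g: "clifford_pair g g'" "clifford_pair g' g" and S: "open S" "x \<in> S" and f: "smooth_on f S"
  shows "nabla g X (nabla g' Y (nabla g Z f)) x + nabla g X (nabla g' Z (nabla g Y f)) x
    = nabla g Y (nabla g' Z (nabla g X f)) x + nabla g Z (nabla g' Y (nabla g X f)) x"
proof -
  have "nabla g X (nabla g' Y (nabla g Z f)) x + nabla g X (nabla g' Z (nabla g Y f)) x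
     = nabla g X (\<lambda>y. nabla g' Y (nabla g Z f) y + nabla g' Z (nabla g Y f) y) x"
    using S f by (simp add: nabla_add smooth_on_nabla)
  also have "\<dots> = nabla g X (Lap Y Z f) x"
    by (rule nabla_cong[OF S]) (rule nabla_nabla_sym[OF g(2) S(1) _ f])
  also have "\<dots> = nabla g Y (nabla g' Z (nabla g X f)) x + nabla g Z (nabla g' Y (nabla g X f)) x"
    using Lap_nabla[OF S f] nabla_nabla_sym[OF g(1) S smooth_on_nabla[OF S(1) f]] by metis
  finally show ?thesis .
qed

lemma sum_UNIV_Plus:
  fixes f :: "'a::finite + 'b::finite \<Rightarrow> 'c::comm_monoid_add"
  shows "sum f UNIV = (\<Sum>a\<in>UNIV. f (Inl a)) + (\<Sum>b\<in>UNIV. f (Inr b))"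
  by (subst UNIV_Plus_UNIV[symmetric], subst sum.Plus) simp_all

lemma matrix_mult_add_rdistrib:
  fixes M N :: "complex^'a::finite^'b::finite"
  shows "(M + N) ** P = M ** P + N ** P"
  by (simp add: vec_eq_iff matrix_matrix_mult_def distrib_right sum.distrib)

lemma mat_commute:
  fixes M :: "complex^'a::finite^'b::finite"
  shows "M ** mat r = mat r ** M"
  by (simp add: vec_eq_iff matrix_matrix_mult_def mat_def if_distrib[of "\<lambda>x. x * _"] if_distrib[of "\<lambda>x. _ * x"] cong: if_cong)

text \<open>
  For even \<open>n\<close> these are the two diagonal blocks of the Clifford relations of the odd action; for odd \<open>n\<close> they
  are the Clifford relations of \<open>c\<close>, directly on \<open>S\<^sup>+\<close> and conjugated by \<open>J\<close> on \<open>S\<^sup>-\<close>.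
\<close>

lemma spinor_modules_clifford_pair:
  fixes gp :: "'n::finite \<Rightarrow> complex^'p::finite^'m::finite"
  assumes "spinor_modules gp gm"
  shows "clifford_pair gp gm" "clifford_pair gm gp"
proof -
  have "clifford_pair gp gm \<and> clifford_pair gm gp"
  proof (cases "even CARD('n)")
    case True
    then have c: "odd_action gp gm i ** odd_action gp gm j + odd_action gp gm j ** odd_action gp gm i
        = mat (if i = j then -2 else 0)" for i j
      using assms by (simp add: spinor_modules_def spinor_module_def clifford_module_def)
    have 1: "(odd_action gp gm i ** odd_action gp gm j) $ Inl a $ Inl b = (gm i ** gp j) $ a $ b" for i j a b
      by (simp add: matrix_matrix_mult_def odd_action_def sum_UNIV_Plus)
    have 2: "(odd_action gp gm i ** odd_action gp gm j) $ Inr a $ Inr b = (gp i ** gm j) $ a $ b" for i j a b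
      by (simp add: matrix_matrix_mult_def odd_action_def sum_UNIV_Plus)
    have "(gm i ** gp j + gm j ** gp i) $ a $ b = mat (if i = j then -2 else 0) $ a $ b" for i j a b
      using c[of i j, THEN arg_cong[of _ _ "\<lambda>M. M $ Inl a $ Inl b"]] 1 by (simp add: mat_def)
    moreover have "(gp i ** gm j + gp j ** gm i) $ a $ b = mat (if i = j then -2 else 0) $ a $ b" for i j a b
      using c[of i j, THEN arg_cong[of _ _ "\<lambda>M. M $ Inr a $ Inr b"]] 2 by (simp add: mat_def)
    ultimately show ?thesis
      unfolding clifford_pair_def by (metis vec_eq_iff)
  next
    case False
    then obtain J :: "complex^'p^'m" and J' :: "complex^'m^'p" and c where J: "J ** J' = mat 1" "J' ** J = mat 1"
      and c: "clifford_module c" and g: "\<And>j. gp j = J ** c j" "\<And>j. gm j = c j ** J'"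
      using assms unfolding spinor_modules_def spinor_module_def by auto
    have cc: "c i ** c j + c j ** c i = mat (if i = j then -2 else 0)" for i j
      using c by (simp add: clifford_module_def)
    have "gm i ** gp j = c i ** c j" for i j
      unfolding g by (metis J(2) matrix_mul_assoc matrix_mul_lid)
    then have "clifford_pair gm gp"
      by (simp add: clifford_pair_def cc)
    moreover have "gp i ** gm j + gp j ** gm i = mat (if i = j then -2 else 0)" for i j
    proof -
      have "gp i ** gm j + gp j ** gm i = J ** (c i ** c j + c j ** c i) ** J'"
        unfolding g by (simp add: matrix_add_ldistrib matrix_mult_add_rdistrib matrix_mul_assoc)
      also have "\<dots> = mat (if i = j then -2 else 0)"
        by (simp add: cc mat_commute[of J]) (simp add: J flip: matrix_mul_assoc)
      finally show ?thesis .
    qed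
    ultimately show ?thesis
      by (simp add: clifford_pair_def)
  qed
  then show "clifford_pair gp gm" "clifford_pair gm gp" by auto
qed

section \<open>Exactness for Clifford symbols\<close>

lemma linear_vector_smult: "linear (\<lambda>v::complex^'a. c *s v)"
  by (auto intro!: linearI simp: vec_eq_iff algebra_simps)

lemma of_real_smult: "complex_of_real r *s v = r *\<^sub>R v"
  by (simp add: vec_eq_iff) (simp add: scaleR_conv_of_real)

lemma xi_sym_eq:
  "xi_sym g \<xi> A v = (\<Sum>j\<in>UNIV. \<xi> $ A $ j *\<^sub>R (- \<i> *s (g j *v v)))"
  unfolding xi_sym_def of_real_smult
  by (simp only: linear_sum[OF linear_vector_smult] linear_cmul[OF linear_vector_smult])

lemma linear_xi_sym: 
  fixes g :: "'n::finite \<Rightarrow> complex^'a::finite^'b::finite"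
  shows "linear (xi_sym g \<xi> A)"
  unfolding xi_sym_eq [abs_def]
  by (intro linear_compose_sum ballI linear_compose_scale_right
      linear_compose[OF matrix_vector_mul_linear linear_vector_smult, unfolded o_def])

lemma xi_sym_xi_sym:
  fixes g :: "'n::finite \<Rightarrow> complex^'b::finite^'a::finite"
  shows "xi_sym g \<xi> B (xi_sym g' \<xi> C v)
    = - (\<Sum>i\<in>UNIV. \<Sum>j\<in>UNIV. (\<xi> $ B $ i * \<xi> $ C $ j) *\<^sub>R ((g i ** g' j) *v v))"
proof -
  have "g i *v (- \<i> *s w) = - \<i> *s (g i *v w)" for i w
    by (rule vector_scalar_commute)
  then have "xi_sym g \<xi> B (xi_sym g' \<xi> C v)
    = (\<Sum>i\<in>UNIV. \<Sum>j\<in>UNIV. \<xi> $ B $ i *\<^sub>R \<xi> $ C $ j *\<^sub>R (- \<i> *s (- \<i> *s (g i *v (g' j *v v)))))"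
    unfolding xi_sym_eq
    by (simp only: linear_sum[OF matrix_vector_mul_linear] linear_cmul[OF matrix_vector_mul_linear]
        linear_sum[OF linear_vector_smult] linear_cmul[OF linear_vector_smult] scaleR_sum_right)
  then show ?thesis
    by (simp add: matrix_vector_mul_assoc sum_negf)
qed

text \<open>
  The sign of \<open>(-\<i>)\<^sup>2\<close> cancels the sign in the Clifford relations.
\<close>

lemma xi_sym_clifford:
  fixes g :: "'n::finite \<Rightarrow> complex^'b::finite^'a::finite"
  assumes "clifford_pair g g'"
  shows "xi_sym g \<xi> B (xi_sym g' \<xi> C v) + xi_sym g \<xi> C (xi_sym g' \<xi> B v)
    = (2 * (\<xi> $ B \<bullet> \<xi> $ C)) *\<^sub>R v"
proof -
  have "(\<Sum>i\<in>UNIV. \<Sum>j\<in>UNIV. (\<xi> $ C $ i * \<xi> $ B $ j) *\<^sub>R ((g i ** g' j) *v v))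
    = (\<Sum>i\<in>UNIV. \<Sum>j\<in>UNIV. (\<xi> $ B $ i * \<xi> $ C $ j) *\<^sub>R ((g j ** g' i) *v v))"
    by (subst sum.swap) (simp add: mult.commute)
  then have "xi_sym g \<xi> B (xi_sym g' \<xi> C v) + xi_sym g \<xi> C (xi_sym g' \<xi> B v)
    = - (\<Sum>i\<in>UNIV. \<Sum>j\<in>UNIV. (\<xi> $ B $ i * \<xi> $ C $ j) *\<^sub>R ((g i ** g' j) *v v + (g j ** g' i) *v v))"
    by (simp add: xi_sym_xi_sym scaleR_add_right sum.distrib)
  also have "\<dots> = - (\<Sum>i\<in>UNIV. (\<xi> $ B $ i * \<xi> $ C $ i) *\<^sub>R (- 2 *\<^sub>R v))"
    by (simp only: clifford_pairD[OF assms] if_distrib[of "scaleR _"] scaleR_zero_right) simp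
  also have "\<dots> = (2 * (\<xi> $ B \<bullet> \<xi> $ C)) *\<^sub>R v"
    by (simp add: inner_vec_def scaleR_sum_left sum_distrib_left sum_negf mult.commute)
  finally show ?thesis .
qed

text \<open>
  The maps \<open>\<xi>\<^sub>A : S\<^sup>+ \<rightarrow> S\<^sup>-\<close> and \<open>\<xi>\<^sub>A : S\<^sup>- \<rightarrow> S\<^sup>+\<close>, with \<open>q\<close> the Gram matrix of \<open>\<xi>\<close>.
\<close>

locale clifford_symbol =
  fixes P :: "'k::finite \<Rightarrow> complex^'p::finite \<Rightarrow> complex^'m::finite"
    and Q :: "'k \<Rightarrow> complex^'m \<Rightarrow> complex^'p"
    and q :: "'k \<Rightarrow> 'k \<Rightarrow> real"
  assumes linear_P: "linear (P A)" and linear_Q: "linear (Q A)"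
    and PQ: "P A (Q B v) + P B (Q A v) = (2 * q A B) *\<^sub>R v"
    and QP: "Q A (P B w) + Q B (P A w) = (2 * q A B) *\<^sub>R w"
begin

lemmas P_simps = linear_0[OF linear_P] linear_add[OF linear_P] linear_diff[OF linear_P]
  linear_neg[OF linear_P] linear_cmul[OF linear_P]
lemmas Q_simps = linear_0[OF linear_Q] linear_add[OF linear_Q] linear_diff[OF linear_Q]
  linear_neg[OF linear_Q] linear_cmul[OF linear_Q]

lemma PQ_same: "P A (Q A v) = q A A *\<^sub>R v"
proof -
  have "2 *\<^sub>R P A (Q A v) = 2 *\<^sub>R (q A A *\<^sub>R v)" using PQ[of A A v] by (simp add: scaleR_2)
  then show ?thesis by (subst (asm) scaleR_cancel_left) simp
qed

lemma QP_same: "Q A (P A v) = q A A *\<^sub>R v"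
proof -
  have "2 *\<^sub>R Q A (P A v) = 2 *\<^sub>R (q A A *\<^sub>R v)" using QP[of A A v] by (simp add: scaleR_2)
  then show ?thesis by (subst (asm) scaleR_cancel_left) simp
qed

lemma relation_PQP: "P X (Q Y (P Z w)) + P X (Q Z (P Y w)) = P Y (Q Z (P X w)) + P Z (Q Y (P X w))"
proof -
  have "P X (Q Y (P Z w)) + P X (Q Z (P Y w)) = P X (Q Y (P Z w) + Q Z (P Y w))"
    by (simp add: P_simps)
  also have "\<dots> = P Y (Q Z (P X w)) + P Z (Q Y (P X w))"
    by (simp only: QP PQ P_simps)
  finally show ?thesis .
qed

lemma relation_QPQ: "Q X (P Y (Q Z v)) + Q X (P Z (Q Y v)) = Q Y (P Z (Q X v)) + Q Z (P Y (Q X v))"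
proof -
  have "Q X (P Y (Q Z v)) + Q X (P Z (Q Y v)) = Q X (P Y (Q Z v) + P Z (Q Y v))"
    by (simp add: Q_simps)
  also have "\<dots> = Q Y (P Z (Q X v)) + Q Z (P Y (Q X v))"
    by (simp only: QP PQ Q_simps)
  finally show ?thesis .
qed

lemma Q_young21: "Q D (young21 t A B C) = young21 (\<lambda>A B C. Q D (t A B C)) A B C"
  by (simp add: young_defs Q_simps)
lemma P_young21: "P D (young21 t A B C) = young21 (\<lambda>A B C. P D (t A B C)) A B C"
  by (simp add: young_defs P_simps)

lemma young22_image_eq_0:
  "young22 (\<lambda>D A B C. Q D (young21 (\<lambda>A B C. P A (Q B (F C))) A B C)) D A B C = 0"
  unfolding Q_young21 by (rule young22_young21_eq_0) (rule relation_QPQ)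

lemma young311_image_eq_0:
  "young311 (\<lambda>E D A B C. P E (Q D (young21 (\<lambda>A B C. P A (Q B (F C))) A B C))) E D A B C = 0"
  unfolding Q_young21 P_young21
  by (rule young311_young21_eq_0) (rule relation_PQP, metis P_simps(2) relation_QPQ)

text \<open>
  From here on \<open>z\<close> is an index with \<open>\<xi>\<^sub>z \<noteq> 0\<close>, so that \<open>\<xi>\<^sub>z\<close> is invertible in both directions.
\<close>

context
  fixes z :: 'k
  assumes z: "q z z \<noteq> 0"
begin

lemma Q_inj: "Q z v = 0 \<Longrightarrow> v = 0"
  using PQ_same[of z v] z by (simp add: P_simps)

lemma P_inj: "P z v = 0 \<Longrightarrow> v = 0"
  using QP_same[of z v] z by (simp add: Q_simps)

lemma exact_1:
  assumes "\<And>A B C. young21 (\<lambda>A B C. P A (Q B (F C))) A B C = 0"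
  shows "F A = P A ((1 / q z z) *\<^sub>R Q z (F z))"
proof -
  have "young21 (\<lambda>A B C. P A (Q B (F C))) A z z = P A (Q z (F z)) - P z (Q z (F A))"
    by (simp add: young_defs vec_eq_iff field_simps)
  then have "P A (Q z (F z)) = q z z *\<^sub>R F A"
    using assms[of A z z] by (simp add: PQ_same)
  then show ?thesis
    using z by (simp add: P_simps)
qed

text \<open>
  The condition \<open>h\<^sub>A\<^sub>z\<^sub>z = 0\<close> fixes the freedom of adding elements of the image of \<open>\<sigma>\<^sub>1\<close>. The components \<open>h\<^sub>z\<^sub>A\<^sub>B\<close> vanish by the
  component \<open>(z,z,A,B)\<close> of the first equation. What is left with an index \<open>z\<close>, namely
  \<open>h\<^sub>A\<^sub>z\<^sub>B\<close>, is then skew in \<open>A, B\<close> and vanishes by the component \<open>(A,z,B,z,z)\<close> of the second. Finally, in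
  the component \<open>(z,A,B,C)\<close> of the first equation only \<open>\<xi>\<^sub>z\<close> applied to a multiple of \<open>h\<^sub>A\<^sub>B\<^sub>C\<close> survives.
\<close>

lemma exact_2_gauge:
  fixes h :: "'k \<Rightarrow> 'k \<Rightarrow> 'k \<Rightarrow> complex^'m"
  assumes sym: "\<And>A B C. h A B C = h A C B"
    and cyc: "\<And>A B C. h A B C + h B C A + h C A B = 0"
    and k1: "\<And>D A B C. young22 (\<lambda>D A B C. Q D (h A B C)) D A B C = 0"
    and k2: "\<And>E D A B C. young311 (\<lambda>E D A B C. P E (Q D (h A B C))) E D A B C = 0"
    and gauge: "\<And>A. h A z z = 0"
  shows "h A B C = 0"
proof -
  have mixed: "h A B C + h A C B - h C B A - h B C A = 3 *\<^sub>R h A B C" for A B C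
  proof -
    have "h C A B = - h A B C - h B C A"
      using cyc[of A B C] by (metis add.commute add_diff_cancel_left' diff_0 minus_diff_eq diff_minus_eq_add)
    then show ?thesis
      using sym[of A B C] sym[of C A B] by (simp add: vec_eq_iff) (simp add: scaleR_conv_of_real)
  qed
  have zA: "h z z A = 0" "h z A z = 0" for A
  proof -
    have "2 *\<^sub>R h z z A = 0"
      using cyc[of A z z] gauge[of A] sym[of z A z] by (simp add: scaleR_2)
    then show "h z z A = 0" "h z A z = 0" using sym[of z A z] by auto
  qed
  have zAB: "h z A B = 0" for A B
  proof -
    have "young22 (\<lambda>D A B C. Q D (h A B C)) z z A B
        = Q z (h z A B + h z B A - h B A z - h A B z)"
      by (simp add: young_defs Q_simps gauge zA vec_eq_iff field_simps)
    then have "Q z (3 *\<^sub>R h z A B) = 0"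
      using k1[of z z A B] by (simp add: mixed)
    from Q_inj[OF this] show ?thesis by simp
  qed
  have AzB: "h A z B = 0" "h A B z = 0" for A B
  proof -
    have anti: "h B z A = - h A z B"
      using cyc[of z A B] zAB[of A B] sym[of A B z] by (simp add: add_eq_0_iff)
    have "young311 (\<lambda>E D A B C. P E (Q D (h A B C))) A z B z z = 6 *\<^sub>R P z (Q z (h A z B - h B z A))"
      by (simp add: young_defs Q_simps P_simps gauge zA zAB vec_eq_iff)
        (simp add: scaleR_conv_of_real algebra_simps)
    then have "P z (Q z (h A z B - h B z A)) = 0"
      using k2[of A z B z z] by simp
    then have "h A z B - h B z A = 0"
      using P_inj Q_inj by blast
    then have "2 *\<^sub>R h A z B = 0"
      by (simp add: anti scaleR_2)
    then show "h A z B = 0" "h A B z = 0" using sym[of A B z] by auto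
  qed
  have "young22 (\<lambda>D A B C. Q D (h A B C)) z A B C
      = (1/2) *\<^sub>R Q z (h A B C + h A C B - h C B A - h B C A)"
    by (simp add: young_defs Q_simps gauge zA zAB AzB vec_eq_iff field_simps)
  then have "Q z (3 *\<^sub>R h A B C) = 0"
    using k1[of z A B C] by (simp add: mixed)
  from Q_inj[OF this] show ?thesis by simp
qed

lemma exact_2:
  fixes h :: "'k \<Rightarrow> 'k \<Rightarrow> 'k \<Rightarrow> complex^'m"
  assumes sym: "\<And>A B C. h A B C = h A C B"
    and cyc: "\<And>A B C. h A B C + h B C A + h C A B = 0"
    and k1: "\<And>D A B C. young22 (\<lambda>D A B C. Q D (h A B C)) D A B C = 0"
    and k2: "\<And>E D A B C. young311 (\<lambda>E D A B C. P E (Q D (h A B C))) E D A B C = 0"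
  shows "h A B C = young21 (\<lambda>A B C. P A (Q B ((- 1 / q z z) *\<^sub>R h C z z))) A B C"
proof -
  define F where "F A = (- 1 / q z z) *\<^sub>R h A z z" for A
  define H where "H = young21 (\<lambda>A B C. P A (Q B (F C)))"
  \<comment> \<open>By the cyclic identity; hence the component \<open>Azz\<close> of \<open>\<sigma>\<^sub>1 F\<close> is \<open>h A z z\<close>.\<close>
  have "3 *\<^sub>R h z z z = 0"
    using cyc[of z z z] by (simp add: vec_eq_iff)
  then have hz: "h z z z = 0" by simp
  then have Fz: "F z = 0" by (simp add: F_def)
  have "h A B C - H A B C = 0"
  proof (rule exact_2_gauge)
    fix E D A B C
    show "h A B C - H A B C = h A C B - H A C B"
      using sym[of A B C] by (simp add: H_def young_defs algebra_simps)
    have "H A B C + H B C A + H C A B = 0"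
      by (simp add: H_def young_defs vec_eq_iff field_simps)
    moreover have "h A B C - H A B C + (h B C A - H B C A) + (h C A B - H C A B)
        = (h A B C + h B C A + h C A B) - (H A B C + H B C A + H C A B)"
      by (simp add: algebra_simps)
    ultimately show "h A B C - H A B C + (h B C A - H B C A) + (h C A B - H C A B) = 0"
      using cyc by simp
    have "young22 (\<lambda>D A B C. Q D (h A B C - H A B C)) D A B C
      = young22 (\<lambda>D A B C. Q D (h A B C)) D A B C - young22 (\<lambda>D A B C. Q D (H A B C)) D A B C"
      by (simp add: young_defs Q_simps vec_eq_iff field_simps)
    then show "young22 (\<lambda>D A B C. Q D (h A B C - H A B C)) D A B C = 0"
      using k1 young22_image_eq_0[of F] by (simp add: H_def)
    have "young311 (\<lambda>E D A B C. P E (Q D (h A B C - H A B C))) E D A B C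
      = young311 (\<lambda>E D A B C. P E (Q D (h A B C))) E D A B C
        - young311 (\<lambda>E D A B C. P E (Q D (H A B C))) E D A B C"
      by (simp add: young_defs Q_simps P_simps vec_eq_iff field_simps)
    then show "young311 (\<lambda>E D A B C. P E (Q D (h A B C - H A B C))) E D A B C = 0"
      using k2 young311_image_eq_0[of F] by (simp add: H_def)
    have "H A z z = P A (Q z (F z)) - P z (Q z (F A))"
      by (simp add: H_def young_defs vec_eq_iff field_simps)
    also have "\<dots> = h A z z"
      using z by (simp add: Fz hz P_simps Q_simps PQ_same F_def)
    finally show "h A z z - H A z z = 0" by simp
  qed
  then show ?thesis
    by (simp add: H_def F_def)
qed

end

end

section \<open>The complex and its symbol sequence\<close>

lemma young21_eq_0:
  assumes "\<And>X Y Z. t X Y Z + t X Z Y = t Y Z X + t Z Y X"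
  shows "young21 t A B C = 0"
proof -
  have "young21 t A B C = (1/2) *\<^sub>R (t A B C + t A C B - (t B C A + t C B A))"
    unfolding young_defs by (simp add: algebra_simps)
  then show ?thesis
    using assms[of A B C] by simp
qed

lemma smooth_on_vec_nth:
  fixes f :: "'a::euclidean_space \<Rightarrow> 'b::euclidean_space^'i::finite"
  shows "\<lbrakk>open S; smooth_on f S\<rbrakk> \<Longrightarrow> smooth_on (\<lambda>x. f x $ i) S"
  by (simp add: smooth_on_vec_iff[of S f])

lemma smooth_on_young21:
  assumes "open S" "\<And>A B C. smooth_on (t A B C) S"
  shows "smooth_on (\<lambda>x. young21 (\<lambda>A B C. t A B C x) A B C) S"
  unfolding young_defs using assms by (intro smooth_on_add smooth_on_scaleR smooth_on_diff)

lemma nabla_young21: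
  fixes g :: "'n::finite \<Rightarrow> complex^'a::finite^'b::finite"
  assumes "open S" "x \<in> S" "\<And>A B C. smooth_on (t A B C) S"
  shows "nabla g D (\<lambda>y. young21 (\<lambda>A B C. t A B C y) A B C) x = young21 (\<lambda>A B C. nabla g D (t A B C) x) A B C"
  unfolding young_defs using assms
  by (simp add: nabla_add nabla_scaleR nabla_diff smooth_on_add smooth_on_scaleR smooth_on_diff)

lemma nabla_alt2:
  fixes g :: "'n::finite \<Rightarrow> complex^'a::finite^'b::finite"
  assumes "open S" "x \<in> S" "\<And>A B. smooth_on (t A B) S"
  shows "nabla g D (\<lambda>y. alt2 (\<lambda>A B. t A B y) A B) x = alt2 (\<lambda>A B. nabla g D (t A B) x) A B"
  unfolding young_defs using assms
  by (simp add: nabla_scaleR nabla_diff smooth_on_scaleR smooth_on_diff)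

lemma smooth_on_alt2:
  assumes "open S" "\<And>A B. smooth_on (t A B) S"
  shows "smooth_on (\<lambda>x. alt2 (\<lambda>A B. t A B x) A B) S"
  unfolding young_defs using assms by (intro smooth_on_scaleR smooth_on_diff)

lemma D1_young: "D1 gp gm F x
   = vec_lambda (\<lambda>(A, B, C). young21 (\<lambda>A B C. nabla gp A (nabla gm B (\<lambda>y. F y $ C)) x) A B C)"
  by (simp add: D1_def young21_def)

text \<open>
  The operators were written with derivatives of skewsymmetrized functions; on smooth functions the
  derivatives may be moved inside the skewsymmetrization.
\<close>

lemma D2'_young:
  fixes gm :: "'n::finite \<Rightarrow> complex^'m::finite^'p::finite"
  assumes "open S" "x \<in> S" "smooth_on h S"
  shows "D2' gm h x
   = vec_lambda (\<lambda>(D, A, B, C). young22 (\<lambda>D A B C. nabla gm D (\<lambda>y. h y $ (A, B, C)) x) D A B C)"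
  using assms by (simp add: D2'_def young22_def nabla_alt2 smooth_on_vec_nth)

lemma D2''_young:
  fixes gm :: "'n::finite \<Rightarrow> complex^'m::finite^'p::finite"
  assumes S: "open S" "x \<in> S" and h: "smooth_on h S"
  shows "D2'' gp gm h x
   = vec_lambda (\<lambda>(E, D, A, B, C). (1/2) *\<^sub>R
       young311 (\<lambda>E D A B C. nabla gp E (nabla gm D (\<lambda>y. h y $ (A, B, C))) x) E D A B C)"
proof -
  have s: "smooth_on (\<lambda>y. h y $ (A, B, C)) S" for A B C
    using h S by (simp add: smooth_on_vec_nth)
  have 1: "nabla gp D (\<lambda>z. alt2 (\<lambda>E A. nabla gm E (\<lambda>y. h y $ (A, B, C)) z) E A) x
    = alt2 (\<lambda>E A. nabla gp D (nabla gm E (\<lambda>y. h y $ (A, B, C))) x) E A" for D E A B C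
    using S s by (simp add: nabla_alt2 smooth_on_nabla)
  have 2: "nabla gp B (nabla gm C (\<lambda>y. alt2 (\<lambda>E A. h y $ (E, D, A)) E A)) x
    = alt2 (\<lambda>E A. nabla gp B (nabla gm C (\<lambda>y. h y $ (E, D, A))) x) E A" for B C D E A
  proof -
    have "nabla gp B (nabla gm C (\<lambda>y. alt2 (\<lambda>E A. h y $ (E, D, A)) E A)) x
      = nabla gp B (\<lambda>y. alt2 (\<lambda>E A. nabla gm C (\<lambda>y. h y $ (E, D, A)) y) E A) x"
      using S s by (intro nabla_cong[OF S] nabla_alt2)
    then show ?thesis
      using S s by (simp add: nabla_alt2 smooth_on_nabla)
  qed
  have 3: "alt2 t E A + alt2 t' E A = alt2 (\<lambda>E A. t E A + t' E A) E A" for t t' :: "'c \<Rightarrow> 'c \<Rightarrow> complex^'m" and E A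
    by (simp add: alt2_def algebra_simps)
  show ?thesis
    unfolding D2''_def young311_def Delta_def 1 2 3 ..
qed

lemma sigma1_young: "sigma1 gp gm \<xi> F
   = vec_lambda (\<lambda>(A, B, C). young21 (\<lambda>A B C. xi_sym gp \<xi> A (xi_sym gm \<xi> B (F $ C))) A B C)"
  by (simp add: sigma1_def young21_def)

lemma linear_alt2: "linear L \<Longrightarrow> L (alt2 t A B) = alt2 (\<lambda>A B. L (t A B)) A B"
  by (simp add: alt2_def linear_cmul linear_diff)

lemma sigma2'_young:
  fixes gm :: "'n::finite \<Rightarrow> complex^'m::finite^'p::finite"
  shows "sigma2' gm \<xi> h
   = vec_lambda (\<lambda>(D, A, B, C). young22 (\<lambda>D A B C. xi_sym gm \<xi> D (h $ (A, B, C))) D A B C)"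
  unfolding sigma2'_def young22_def linear_alt2[OF linear_xi_sym] ..

lemma sigma2''_young:
  fixes gm :: "'n::finite \<Rightarrow> complex^'m::finite^'p::finite"
  shows "sigma2'' gp gm \<xi> h
   = vec_lambda (\<lambda>(E, D, A, B, C). (1/2) *\<^sub>R
       young311 (\<lambda>E D A B C. xi_sym gp \<xi> E (xi_sym gm \<xi> D (h $ (A, B, C)))) E D A B C)"
proof -
  have 3: "alt2 t E A + alt2 t' E A = alt2 (\<lambda>E A. t E A + t' E A) E A" for t t' :: "'c \<Rightarrow> 'c \<Rightarrow> complex^'m" and E A
    by (simp add: alt2_def algebra_simps)
  show ?thesis
    unfolding sigma2''_def young311_def xi_sym2_def linear_alt2[OF linear_xi_sym] 3 ..
qed

lemma smooth_on_D0:
  fixes gp :: "'n::finite \<Rightarrow> complex^'p::finite^'m::finite"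
  assumes "open S" "smooth_on f S"
  shows "smooth_on (D0 gp f) S"
  using assms by (simp add: smooth_on_vec_iff[of S "D0 gp f"] D0_def smooth_on_nabla)

lemma smooth_on_D1:
  fixes gp :: "'n::finite \<Rightarrow> complex^'p::finite^'m::finite"
  assumes "open S" "smooth_on F S"
  shows "smooth_on (D1 gp gm F) S"
  using assms by (auto simp: smooth_on_vec_iff[of S "D1 gp gm F"] D1_young
      intro!: smooth_on_young21 smooth_on_nabla smooth_on_vec_nth)

lemma smooth_on_D2':
  fixes gm :: "'n::finite \<Rightarrow> complex^'m::finite^'p::finite"
  assumes "open S" "smooth_on h S"
  shows "smooth_on (D2' gm h) S"
  using assms by (auto simp: smooth_on_vec_iff[of S "D2' gm h"] D2'_def symsum2_def
      intro!: smooth_on_add smooth_on_alt2 smooth_on_nabla smooth_on_vec_nth)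

lemma smooth_on_D2'':
  fixes gm :: "'n::finite \<Rightarrow> complex^'m::finite^'p::finite"
    and h :: "real^'n^'k::finite \<Rightarrow> complex^'m^('k \<times> 'k \<times> 'k)"
  assumes "open S" "smooth_on h S"
  shows "smooth_on (D2'' gp gm h) S"
proof (rule smooth_on_vec_iff[THEN iffD2, OF assms(1)], rule allI)
  fix i :: "'k \<times> 'k \<times> 'k \<times> 'k \<times> 'k"
  obtain E D A B C where i: "i = (E, D, A, B, C)" by (metis prod.exhaust)
  show "smooth_on (\<lambda>x. D2'' gp gm h x $ i) S"
    unfolding i D2''_def symsum3_def Delta_def vec_lambda_beta prod.case
    by (intro smooth_on_add smooth_on_scaleR smooth_on_alt2 smooth_on_nabla smooth_on_vec_nth assms)
qed

lemma D1_D0: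
  fixes gp :: "'n::finite \<Rightarrow> complex^'p::finite^'m::finite"
  assumes g: "clifford_pair gp gm" "clifford_pair gm gp"
    and S: "open S" "x \<in> S" and f: "smooth_on f S"
  shows "D1 gp gm (D0 gp f) x = 0"
  unfolding D1_young
  by (simp add: vec_eq_iff D0_def young21_eq_0[OF nabla3_relation[OF g S f]])

lemma D2'_D1:
  fixes gp :: "'n::finite \<Rightarrow> complex^'p::finite^'m::finite"
  assumes g: "clifford_pair gp gm" "clifford_pair gm gp"
    and S: "open S" "x \<in> S" and F: "smooth_on F S"
  shows "D2' gm (D1 gp gm F) x = 0"
proof -
  have s: "smooth_on (\<lambda>y. F y $ C) S" for C using F S by (simp add: smooth_on_vec_nth)
  have "nabla gm D (\<lambda>y. D1 gp gm F y $ (A, B, C)) x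
    = young21 (\<lambda>A B C. nabla gm D (nabla gp A (nabla gm B (\<lambda>y. F y $ C))) x) A B C" for D A B C
    using S s by (simp add: D1_young nabla_young21 smooth_on_nabla)
  then have "young22 (\<lambda>D A B C. nabla gm D (\<lambda>y. D1 gp gm F y $ (A, B, C)) x) D A B C = 0" for D A B C
    using young22_young21_eq_0[of "\<lambda>D A B C. nabla gm D (nabla gp A (nabla gm B (\<lambda>y. F y $ C))) x",
      OF nabla3_relation[OF g(2,1) S s]] by simp
  then show ?thesis
    by (simp add: D2'_young[OF S smooth_on_D1[OF S(1) F]] vec_eq_iff)
qed

lemma D2''_D1:
  fixes gp :: "'n::finite \<Rightarrow> complex^'p::finite^'m::finite"
  assumes g: "clifford_pair gp gm" "clifford_pair gm gp"
    and S: "open S" "x \<in> S" and F: "smooth_on F S"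
  shows "D2'' gp gm (D1 gp gm F) x = 0"
proof -
  define t where "t E D A B C = nabla gp E (nabla gm D (nabla gp A (nabla gm B (\<lambda>y. F y $ C)))) x"
    for E D A B C
  have s: "smooth_on (\<lambda>y. F y $ C) S" for C using F S by (simp add: smooth_on_vec_nth)
  have "nabla gp E (nabla gm D (\<lambda>y. D1 gp gm F y $ (A, B, C))) x = young21 (t E D) A B C" for E D A B C
  proof -
    have "nabla gp E (nabla gm D (\<lambda>y. D1 gp gm F y $ (A, B, C))) x
      = nabla gp E (\<lambda>y. young21 (\<lambda>A B C. nabla gm D (nabla gp A (nabla gm B (\<lambda>y. F y $ C))) y) A B C) x"
      by (rule nabla_cong[OF S]) (use S s in \<open>simp add: D1_young nabla_young21 smooth_on_nabla\<close>)
    also have "\<dots> = young21 (t E D) A B C"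
      unfolding t_def using S s by (simp add: nabla_young21 smooth_on_nabla)
    finally show ?thesis .
  qed
  moreover have "young311 (\<lambda>E D. young21 (t E D)) E D A B C = 0" for E D A B C
  proof (rule young311_young21_eq_0)
    fix X Y Z W V
    show "t X Y Z W V + t X Z Y W V = t Y Z X W V + t Z Y X W V"
      unfolding t_def by (rule nabla3_relation[OF g S smooth_on_nabla[OF S(1) s]])
    have a: "nabla gp X (\<lambda>y. u y + v y) x = nabla gp X u x + nabla gp X v x"
      if "smooth_on u S" "smooth_on v S" for u v
      by (rule nabla_add[OF S that])
    have "t X Y Z W V + t X Y W Z V
      = nabla gp X (\<lambda>y. nabla gm Y (nabla gp Z (nabla gm W (\<lambda>y. F y $ V))) y
            + nabla gm Y (nabla gp W (nabla gm Z (\<lambda>y. F y $ V))) y) x"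
      unfolding t_def by (rule a[symmetric]) (intro smooth_on_nabla S s)+
    also have "\<dots> = nabla gp X (\<lambda>y. nabla gm Z (nabla gp W (nabla gm Y (\<lambda>y. F y $ V))) y
            + nabla gm W (nabla gp Z (nabla gm Y (\<lambda>y. F y $ V))) y) x"
      by (rule nabla_cong[OF S]) (rule nabla3_relation[OF g(2,1) S(1) _ s])
    also have "\<dots> = t X Z W Y V + t X W Z Y V"
      unfolding t_def by (rule a) (intro smooth_on_nabla S s)+
    finally show "t X Y Z W V + t X Y W Z V = t X Z W Y V + t X W Z Y V" .
  qed
  ultimately have "young311 (\<lambda>E D A B C. nabla gp E (nabla gm D (\<lambda>y. D1 gp gm F y $ (A, B, C))) x) E D A B C = 0"
    for E D A B C by simp
  then show ?thesis
    by (simp add: D2''_young[OF S smooth_on_D1[OF S(1) F]] vec_eq_iff)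
qed

text \<open>
  The algebraic symmetries of the values of \<open>h\<close> hold on the open set \<open>S\<close>, so they may be differentiated.
\<close>

lemma D2''_in_V3'':
  fixes gm :: "'n::finite \<Rightarrow> complex^'m::finite^'p::finite"
  assumes S: "open S" "x \<in> S" and h: "smooth_on h S" and V: "\<And>y. y \<in> S \<Longrightarrow> h y \<in> V2"
  shows "D2'' gp gm h x \<in> V3''"
  unfolding D2''_young[OF S h]
proof (rule young311_in_V3'')
  fix X Y A B C
  have s: "smooth_on (\<lambda>y. h y $ (A, B, C)) S" for A B C
    using h S by (simp add: smooth_on_vec_nth)
  have a: "nabla g D (\<lambda>y. u y + v y) x = nabla g D u x + nabla g D v x"
    if "smooth_on u S" "smooth_on v S" "x \<in> S" for u v x D and g :: "'n \<Rightarrow> complex^'s::finite^'t::finite"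
    by (rule nabla_add[OF S(1) that(3,1,2)])
  show "nabla gp X (nabla gm Y (\<lambda>y. h y $ (A, B, C))) x = nabla gp X (nabla gm Y (\<lambda>y. h y $ (A, C, B))) x"
    by (intro nabla_cong[OF S] nabla_cong[OF S(1)]) (use V V2_iff in blast)+
  have "nabla gp X (nabla gm Y (\<lambda>y. h y $ (A, B, C))) x + nabla gp X (nabla gm Y (\<lambda>y. h y $ (B, C, A))) x
      + nabla gp X (nabla gm Y (\<lambda>y. h y $ (C, A, B))) x
     = nabla gp X (\<lambda>y. nabla gm Y (\<lambda>y. h y $ (A, B, C)) y + nabla gm Y (\<lambda>y. h y $ (B, C, A)) y
      + nabla gm Y (\<lambda>y. h y $ (C, A, B)) y) x"
    using S s by (simp add: nabla_add smooth_on_add smooth_on_nabla)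
  also have "\<dots> = nabla gp X (\<lambda>y. 0) x"
  proof (rule nabla_cong[OF S])
    fix y assume y: "y \<in> S"
    have "nabla gm Y (\<lambda>y. h y $ (A, B, C)) y + nabla gm Y (\<lambda>y. h y $ (B, C, A)) y
        + nabla gm Y (\<lambda>y. h y $ (C, A, B)) y
      = nabla gm Y (\<lambda>y. h y $ (A, B, C) + h y $ (B, C, A) + h y $ (C, A, B)) y"
      using S y s by (simp add: nabla_add smooth_on_add)
    also have "\<dots> = nabla gm Y (\<lambda>y. 0) y"
      by (rule nabla_cong[OF S(1) y]) (use V V2_iff in blast)
    also have "\<dots> = 0" by (simp add: nabla_def pd_def)
    finally show "nabla gm Y (\<lambda>y. h y $ (A, B, C)) y + nabla gm Y (\<lambda>y. h y $ (B, C, A)) y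
        + nabla gm Y (\<lambda>y. h y $ (C, A, B)) y = 0" .
  qed
  also have "\<dots> = 0" by (simp add: nabla_def pd_def)
  finally show "nabla gp X (nabla gm Y (\<lambda>y. h y $ (A, B, C))) x + nabla gp X (nabla gm Y (\<lambda>y. h y $ (B, C, A))) x
      + nabla gp X (nabla gm Y (\<lambda>y. h y $ (C, A, B))) x = 0" .
qed

lemma clifford_symbol_xi_sym:
  fixes gp :: "'n::finite \<Rightarrow> complex^'p::finite^'m::finite"
  assumes "clifford_pair gp gm" "clifford_pair gm gp"
  shows "clifford_symbol (xi_sym gp \<xi>) (xi_sym gm \<xi>) (\<lambda>B C. \<xi> $ B \<bullet> \<xi> $ C)"
  by (rule clifford_symbol.intro) (simp_all add: linear_xi_sym xi_sym_clifford assms)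

lemma symbol_exact:
  fixes gp :: "'n::finite \<Rightarrow> complex^'p::finite^'m::finite" and \<xi> :: "real^'n^'k::finite"
  assumes g: "clifford_pair gp gm" "clifford_pair gm gp" and \<xi>: "\<xi> \<noteq> 0"
  shows "{v \<in> V0. sigma0 gp \<xi> v = 0} = {0}"
    and "{F \<in> V1. sigma1 gp gm \<xi> F = 0} = sigma0 gp \<xi> ` V0"
    and "{h \<in> V2. sigma2' gm \<xi> h = 0} \<inter> {h \<in> V2. sigma2'' gp gm \<xi> h = 0} = sigma1 gp gm \<xi> ` V1"
proof -
  interpret clifford_symbol "xi_sym gp \<xi>" "xi_sym gm \<xi>" "\<lambda>B C. \<xi> $ B \<bullet> \<xi> $ C"
    by (rule clifford_symbol_xi_sym[OF g])
  obtain z where "\<xi> $ z \<noteq> 0"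
    using \<xi> by (auto simp: vec_eq_iff)
  then have z: "\<xi> $ z \<bullet> \<xi> $ z \<noteq> 0" by simp
  show "{v \<in> V0. sigma0 gp \<xi> v = 0} = {0}"
  proof -
    have "v = 0" if "sigma0 gp \<xi> v = 0" for v
      using that P_inj[OF z, of v] by (simp add: sigma0_def vec_eq_iff)
    moreover have "sigma0 gp \<xi> 0 = 0"
      by (simp add: sigma0_def vec_eq_iff P_simps)
    ultimately show ?thesis by (auto simp: V0_def)
  qed
  show "{F \<in> V1. sigma1 gp gm \<xi> F = 0} = sigma0 gp \<xi> ` V0"
  proof (intro equalityI subsetI)
    fix F assume "F \<in> {F \<in> V1. sigma1 gp gm \<xi> F = 0}"
    then have "young21 (\<lambda>A B C. xi_sym gp \<xi> A (xi_sym gm \<xi> B (F $ C))) A B C = 0" for A B C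
      by (simp add: sigma1_young vec_eq_iff)
    from exact_1[OF z this] have "F = sigma0 gp \<xi> ((1 / (\<xi> $ z \<bullet> \<xi> $ z)) *\<^sub>R xi_sym gm \<xi> z (F $ z))"
      unfolding sigma0_def vec_eq_iff by (metis vec_lambda_beta)
    then show "F \<in> sigma0 gp \<xi> ` V0" by (auto simp: V0_def)
  next
    fix F assume "F \<in> sigma0 gp \<xi> ` V0"
    then obtain v where F: "F = sigma0 gp \<xi> v" by auto
    have "young21 (\<lambda>A B C. xi_sym gp \<xi> A (xi_sym gm \<xi> B (xi_sym gp \<xi> C v))) A B C = 0" for A B C
      by (rule young21_eq_0) (rule relation_PQP)
    then show "F \<in> {F \<in> V1. sigma1 gp gm \<xi> F = 0}"
      by (simp add: V1_eq_UNIV F sigma1_young sigma0_def vec_eq_iff)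
  qed
  show "{h \<in> V2. sigma2' gm \<xi> h = 0} \<inter> {h \<in> V2. sigma2'' gp gm \<xi> h = 0} = sigma1 gp gm \<xi> ` V1"
  proof (intro equalityI subsetI)
    fix h assume "h \<in> {h \<in> V2. sigma2' gm \<xi> h = 0} \<inter> {h \<in> V2. sigma2'' gp gm \<xi> h = 0}"
    then have h: "h \<in> V2" and k: "sigma2' gm \<xi> h = 0" "sigma2'' gp gm \<xi> h = 0" by auto
    have sym: "h $ (A, B, C) = h $ (A, C, B)"
      and cyc: "h $ (A, B, C) + h $ (B, C, A) + h $ (C, A, B) = 0" for A B C
      using h unfolding V2_iff by blast+
    have k1: "young22 (\<lambda>D A B C. xi_sym gm \<xi> D (h $ (A, B, C))) D A B C = 0" for D A B C
      using k(1) by (simp add: sigma2'_young vec_eq_iff)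
    have k2: "young311 (\<lambda>E D A B C. xi_sym gp \<xi> E (xi_sym gm \<xi> D (h $ (A, B, C)))) E D A B C = 0" for E D A B C
      using k(2) by (simp add: sigma2''_young vec_eq_iff)
    have "h = sigma1 gp gm \<xi> (\<chi> C. (- 1 / (\<xi> $ z \<bullet> \<xi> $ z)) *\<^sub>R h $ (C, z, z))"
      using exact_2[OF z sym cyc k1 k2] by (simp add: sigma1_young vec_eq_iff)
    then show "h \<in> sigma1 gp gm \<xi> ` V1" by (auto simp: V1_eq_UNIV)
  next
    fix h assume "h \<in> sigma1 gp gm \<xi> ` V1"
    then obtain F where h: "h = sigma1 gp gm \<xi> F" by auto
    have "sigma2' gm \<xi> h = 0"
      by (simp add: h sigma2'_young sigma1_young young22_image_eq_0 vec_eq_iff)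
    moreover have "sigma2'' gp gm \<xi> h = 0"
      by (simp add: h sigma2''_young sigma1_young young311_image_eq_0 vec_eq_iff)
    moreover have "h \<in> V2"
      unfolding h sigma1_young by (rule young21_in_V2)
    ultimately show "h \<in> {h \<in> V2. sigma2' gm \<xi> h = 0} \<inter> {h \<in> V2. sigma2'' gp gm \<xi> h = 0}" by auto
  qed
qed

theorem theorem1p1:
  fixes gp :: "'n::finite \<Rightarrow> complex^'p::finite^'m::finite"
    and gm :: "'n \<Rightarrow> complex^'m^'p"
    and \<Omega> :: "(real^'n^'k::finite) set"
  assumes "CARD('k) \<ge> 3"
    and "spinor_modules gp gm"
    and "open \<Omega>" and "connected \<Omega>" and "\<Omega> \<noteq> {}"
  shows
    "(\<forall>f \<in> Gam \<Omega> V0. D0 gp f \<in> Gam \<Omega> V1)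
   \<and> (\<forall>F \<in> Gam \<Omega> V1. D1 gp gm F \<in> Gam \<Omega> V2)
   \<and> (\<forall>h \<in> Gam \<Omega> V2. D2' gm h \<in> Gam \<Omega> V3' \<and> D2'' gp gm h \<in> Gam \<Omega> V3'')
   \<and> (\<forall>f \<in> Gam \<Omega> V0. \<forall>x\<in>\<Omega>. D1 gp gm (D0 gp f) x = 0)
   \<and> (\<forall>F \<in> Gam \<Omega> V1. \<forall>x\<in>\<Omega>.
        D2' gm (D1 gp gm F) x = 0 \<and> D2'' gp gm (D1 gp gm F) x = 0)
   \<and> (\<forall>\<xi> :: real^'n^'k. \<xi> \<noteq> 0 \<longrightarrow>
        {v \<in> V0. sigma0 gp \<xi> v = 0} = {0}
      \<and> {F \<in> V1. sigma1 gp gm \<xi> F = 0} = sigma0 gp \<xi> ` V0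
      \<and> {h \<in> V2. sigma2' gm \<xi> h = 0} \<inter> {h \<in> V2. sigma2'' gp gm \<xi> h = 0}
          = sigma1 gp gm \<xi> ` V1)"
proof -
  note g = spinor_modules_clifford_pair[OF \<open>spinor_modules gp gm\<close>]
  note \<Omega> = \<open>open \<Omega>\<close>
  show ?thesis
  proof (intro conjI ballI allI impI)
    show "D0 gp f \<in> Gam \<Omega> V1" if "f \<in> Gam \<Omega> V0" for f :: "real^'n^'k \<Rightarrow> complex^'p"
      using that by (auto simp: Gam_def V1_eq_UNIV intro: smooth_on_D0[OF \<Omega>])
    show "D1 gp gm F \<in> Gam \<Omega> V2" if "F \<in> Gam \<Omega> V1" for F
      using that smooth_on_D1[OF \<Omega>] unfolding D1_young by (auto simp: Gam_def D1_young young21_in_V2)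
    fix h :: "real^'n^'k \<Rightarrow> complex^'m^('k \<times> 'k \<times> 'k)"
    assume "h \<in> Gam \<Omega> V2"
    then have h: "smooth_on h \<Omega>" "\<And>x. x \<in> \<Omega> \<Longrightarrow> h x \<in> V2" by (auto simp: Gam_def)
    show "D2' gm h \<in> Gam \<Omega> V3'"
      using smooth_on_D2'[OF \<Omega> h(1)] by (auto simp: Gam_def D2'_young[OF \<Omega> _ h(1)] young22_in_V3')
    show "D2'' gp gm h \<in> Gam \<Omega> V3''"
      using smooth_on_D2''[OF \<Omega> h(1)] D2''_in_V3''[OF \<Omega> _ h] by (auto simp: Gam_def)
  qed (use D1_D0[OF g \<Omega>] D2'_D1[OF g \<Omega>] D2''_D1[OF g \<Omega>] symbol_exact[OF g] in \<open>simp_all add: Gam_def\<close>)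
qed

end
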